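(* Let $\mathcal F$ be a family of (odd, odd)-free Artin groups which has property $\mathcal C$, and let $A_S$ belong to $\mathcal F$. Then the intersection of any two parabolic subgroups of $A_S$ is again a parabolic subgroup of $A_S$.
   Context: Given a finite set $S$ and labels $m_{s,t}=m_{t,s}\in\{2,3,\dots\}\cup\{\infty\}$ for $s\neq t$ in $S$, the Artin group $A_S$ is generated by $S$ with one relation $sts\cdots=tst\cdots$ ($m_{s,t}$ letters on each side) for each pair $s\ne t$ with $m_{s,t}\neq\infty$. Odd and even labels are finite. For $X\subseteq S$, the standard parabolic subgroup $A_X$ is the subgroup generated by $X$ (known to be the Artin group defined by the restricted labels); parabolic subgroups are the conjugates $gA_Xg^{-1}$, $g\in A_S$, $X\subseteq S$. $A_S$ is (odd, odd)-free if no $s\in S$ has two distinct $t,t'\in S$ with $m_{s,t}$ and $m_{s,t'}$ both odd. An (odd, odd)-free Artin group $A_S$ admits ordinary retractions if for every $X\subseteq S$ the assignment $\rho_X(x)=x$ for $x\in X$; $\rho_X(v)=a$ if $v\in S\setminus X$ and $a\in X$ has $m_{v,a}$ odd; $\rho_X(v)=1$ for all other $v\in S\setminus X$, extends to a homomorphism $\rho_X\colon A_S\to A_X$. For $X,Y\subseteq S$, let $O_{X,Y}$ be the set of $x\in X\setminus Y$ for which there is $y\in Y\setminus X$ with $m_{x,y}$ odd, and let $C_{X,Y}=(X\cap Y)\cup O_{X,Y}$. For $x\in S$, $\mathrm{Star}(x)=\{x\}\cup\{t\in S\setminus\{x\}: m_{x,t}\neq\infty\}$. A family of (odd, odd)-free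 Artin groups (with given standard generating sets and labels) has property $\mathcal C$ if: 1. every group in the family admits ordinary retractions, and the family is closed under taking subgraphs: if $A_S$ is in the family and $T\subseteq S$, then $A_T$ (with the restricted labels) is in the family; 2. for every $A_S$ in the family, any $X,Y\subseteq S$ and any $g\in A_S$: if every $x\in S\setminus(C_{X,Y}\cup C_{Y,X})$ satisfies $\mathrm{Star}(x)=S$, then either (a) $A_{C_{X,Y}}=gA_{C_{Y,X}}g^{-1}$, or (b) $A_{C_{X,Y}}\cap gA_{C_{Y,X}}g^{-1}\leqslant dA_Hd^{-1}$ for some $d\in A_S$ and some set $H$ that is a proper subset of $C_{X,Y}$ or a proper subset of $C_{Y,X}$. *)

theory Defs
  imports "HOL-Algebra.Generated_Groups" "HOL-Library.Extended_Nat"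
begin

section \<open>Groups given by generators and relations\<close>

text \<open>The letter \<open>(x, True)\<close> stands for the generator \<open>x\<close>, the letter \<open>(x, False)\<close> for its
  inverse.  The relation set \<open>R\<close> consists of pairs of words over \<open>S\<close> to be identified.\<close>

type_synonym 'a word = "('a \<times> bool) list"

definition words :: "'a set \<Rightarrow> 'a word set" where
  "words S = lists (S \<times> UNIV)"

inductive pres_eq :: "'a set \<Rightarrow> ('a word \<times> 'a word) set \<Rightarrow> 'a word \<Rightarrow> 'a word \<Rightarrow> bool"
  for S :: "'a set" and R :: "('a word \<times> 'a word) set" where
  refl: "w \<in> words S \<Longrightarrow> pres_eq S R w w"
| sym: "pres_eq S R u v \<Longrightarrow> pres_eq S R v u"
| trans: "pres_eq S R u v \<Longrightarrow> pres_eq S R v w \<Longrightarrow> pres_eq S R u w"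
| app: "pres_eq S R u u' \<Longrightarrow> pres_eq S R v v' \<Longrightarrow> pres_eq S R (u @ v) (u' @ v')"
| cancel: "x \<in> S \<Longrightarrow> pres_eq S R [(x, b), (x, \<not> b)] []"
| rel: "(u, v) \<in> R \<Longrightarrow> pres_eq S R u v"

definition pres_class :: "'a set \<Rightarrow> ('a word \<times> 'a word) set \<Rightarrow> 'a word \<Rightarrow> 'a word set" where
  "pres_class S R w = {v. pres_eq S R w v}"

definition presented_group :: "'a set \<Rightarrow> ('a word \<times> 'a word) set \<Rightarrow> 'a word set monoid" where
  "presented_group S R =
     \<lparr>carrier = pres_class S R ` words S,
      mult = (\<lambda>A B. \<Union>u\<in>A. \<Union>v\<in>B. pres_class S R (u @ v)),
      one = pres_class S R []\<rparr>"

lemma pres_eq_words: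
  assumes "R \<subseteq> words S \<times> words S" and "pres_eq S R u v"
  shows "u \<in> words S \<and> v \<in> words S"
  using assms(2,1) by (induction rule: pres_eq.induct) (auto simp: words_def)

lemma pres_class_eq_iff:
  assumes "u \<in> words S"
  shows "pres_class S R u = pres_class S R v \<longleftrightarrow> pres_eq S R u v"
proof
  assume "pres_class S R u = pres_class S R v"
  moreover have "u \<in> pres_class S R u"
    using assms by (simp add: pres_class_def pres_eq.refl)
  ultimately have "u \<in> pres_class S R v"
    by (rule subst)
  then have "pres_eq S R v u"
    by (simp only: pres_class_def mem_Collect_eq)
  then show "pres_eq S R u v"
    by (rule pres_eq.sym)
next
  assume "pres_eq S R u v"
  then have "pres_eq S R u w \<longleftrightarrow> pres_eq S R v w" for w
    using pres_eq.sym pres_eq.trans by metis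
  then show "pres_class S R u = pres_class S R v"
    by (simp add: pres_class_def)
qed

lemma presented_group_mult:
  assumes "u \<in> words S" and "v \<in> words S"
  shows "pres_class S R u \<otimes>\<^bsub>presented_group S R\<^esub> pres_class S R v = pres_class S R (u @ v)"
proof -
  have "pres_class S R (u' @ v') = pres_class S R (u @ v)"
    if "u' \<in> pres_class S R u" "v' \<in> pres_class S R v" for u' v'
  proof -
    have "pres_eq S R (u @ v) (u' @ v')"
      using that unfolding pres_class_def mem_Collect_eq by (rule pres_eq.app)
    then show ?thesis
      using assms pres_class_eq_iff[of "u @ v" S R "u' @ v'"] by (simp add: words_def)
  qed
  moreover have "u \<in> pres_class S R u" "v \<in> pres_class S R v"
    using assms by (simp_all add: pres_class_def pres_eq.refl)
  ultimately have "(\<Union>u'\<in>pres_class S R u. \<Union>v'\<in>pres_class S R v. pres_class S R (u' @ v'))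
      = pres_class S R (u @ v)"
    by blast
  then show ?thesis
    by (simp add: presented_group_def)
qed

lemma pres_eq_inverse:
  assumes "w \<in> words S"
  shows "pres_eq S R (rev (map (\<lambda>(x, b). (x, \<not> b)) w) @ w) []"
  using assms
proof (induction w)
  case Nil
  then show ?case by (auto simp: words_def intro: pres_eq.refl)
next
  case (Cons a w)
  obtain x b where a: "a = (x, b)" by fastforce
  let ?i = "rev (map (\<lambda>(x, b). (x, \<not> b)) w)"
  have x: "x \<in> S" and w: "w \<in> words S" and i: "?i \<in> words S"
    using Cons.prems a by (auto simp: words_def)
  have "pres_eq S R ([(x, \<not> b), (x, b)] @ w) ([] @ w)"
    using pres_eq.cancel[OF x, of R "\<not> b"] pres_eq.refl[OF w, of R]
    by (intro pres_eq.app) auto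
  then have "pres_eq S R (?i @ [(x, \<not> b), (x, b)] @ w) (?i @ [] @ w)"
    by (rule pres_eq.app[OF pres_eq.refl[OF i]])
  then have "pres_eq S R (?i @ [(x, \<not> b), (x, b)] @ w) (?i @ w)"
    by simp
  from pres_eq.trans[OF this Cons.IH[OF w]] show ?case
    using a by simp
qed

lemma group_presented_group: "group (presented_group S R)"
proof (rule groupI)
  let ?G = "presented_group S R"
  have car: "carrier ?G = pres_class S R ` words S" and one: "\<one>\<^bsub>?G\<^esub> = pres_class S R []"
    by (simp_all add: presented_group_def)
  show "x \<otimes>\<^bsub>?G\<^esub> y \<in> carrier ?G" if "x \<in> carrier ?G" "y \<in> carrier ?G" for x y
    using that unfolding car by (auto simp: presented_group_mult) (auto simp: words_def)
  show "\<one>\<^bsub>?G\<^esub> \<in> carrier ?G"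
    unfolding car one by (auto simp: words_def)
  show "x \<otimes>\<^bsub>?G\<^esub> y \<otimes>\<^bsub>?G\<^esub> z = x \<otimes>\<^bsub>?G\<^esub> (y \<otimes>\<^bsub>?G\<^esub> z)"
    if xyz: "x \<in> carrier ?G" "y \<in> carrier ?G" "z \<in> carrier ?G" for x y z
  proof -
    obtain u v w where w: "u \<in> words S" "v \<in> words S" "w \<in> words S"
      and e: "x = pres_class S R u" "y = pres_class S R v" "z = pres_class S R w"
      using xyz unfolding car by auto
    have "u @ v \<in> words S" "v @ w \<in> words S"
      using w by (auto simp: words_def)
    then show ?thesis
      using w by (simp add: e presented_group_mult)
  qed
  show "\<one>\<^bsub>?G\<^esub> \<otimes>\<^bsub>?G\<^esub> x = x" if x: "x \<in> carrier ?G" for x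
  proof -
    obtain w where "w \<in> words S" "x = pres_class S R w"
      using x unfolding car by auto
    moreover have "[] \<in> words S"
      by (simp add: words_def)
    ultimately show ?thesis
      by (simp add: one presented_group_mult)
  qed
  show "\<exists>y\<in>carrier ?G. y \<otimes>\<^bsub>?G\<^esub> x = \<one>\<^bsub>?G\<^esub>" if x: "x \<in> carrier ?G" for x
  proof -
    obtain w where w: "w \<in> words S" "x = pres_class S R w"
      using x unfolding car by auto
    let ?i = "rev (map (\<lambda>(x, b). (x, \<not> b)) w)"
    have i: "?i \<in> words S" using w by (auto simp: words_def)
    then have "?i @ w \<in> words S" using w by (auto simp: words_def)
    then have "pres_class S R ?i \<otimes>\<^bsub>?G\<^esub> x = \<one>\<^bsub>?G\<^esub>"
      unfolding one w(2) presented_group_mult[OF i w(1)]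
      by (simp add: pres_class_eq_iff pres_eq_inverse[OF w(1)])
    moreover have "pres_class S R ?i \<in> carrier ?G"
      using i unfolding car by (rule imageI)
    ultimately show ?thesis
      by (rule bexI)
  qed
qed

section \<open>Artin groups and their parabolic subgroups\<close>

text \<open>The labels are a function \<open>m\<close> of which only the values \<open>m s t\<close> for distinct \<open>s\<close>, \<open>t\<close> in \<open>S\<close>
  are meaningful; the notions below, for vertices and subsets of \<open>S\<close>, ignore all other values.\<close>

type_synonym 'a labels = "'a \<Rightarrow> 'a \<Rightarrow> enat"

definition artin_labels :: "'a set \<Rightarrow> 'a labels \<Rightarrow> bool" where
  "artin_labels S m \<longleftrightarrow> finite S \<and> (\<forall>s\<in>S. \<forall>t\<in>S. s \<noteq> t \<longrightarrow> m s t = m t s \<and> 2 \<le> m s t)"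

definition odd_label :: "'a labels \<Rightarrow> 'a \<Rightarrow> 'a \<Rightarrow> bool" where
  "odd_label m s t \<longleftrightarrow> s \<noteq> t \<and> (\<exists>k. m s t = enat k \<and> odd k)"

definition alternating :: "'a \<Rightarrow> 'a \<Rightarrow> nat \<Rightarrow> 'a word" where
  "alternating s t k = map (\<lambda>i. (if even i then s else t, True)) [0..<k]"

definition artin_relations :: "'a set \<Rightarrow> 'a labels \<Rightarrow> ('a word \<times> 'a word) set" where
  "artin_relations S m =
     {(alternating s t k, alternating t s k) | s t k. s \<in> S \<and> t \<in> S \<and> s \<noteq> t \<and> m s t = enat k}"

definition artin_group :: "'a set \<Rightarrow> 'a labels \<Rightarrow> 'a word set monoid" where
  "artin_group S m = presented_group S (artin_relations S m)"

definition artin_gen :: "'a set \<Rightarrow> 'a labels \<Rightarrow> 'a \<Rightarrow> 'a word set" where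
  "artin_gen S m s = pres_class S (artin_relations S m) [(s, True)]"

lemma group_artin_group: "group (artin_group S m)"
  unfolding artin_group_def by (rule group_presented_group)

definition std_parabolic :: "'a set \<Rightarrow> 'a labels \<Rightarrow> 'a set \<Rightarrow> 'a word set set" where
  "std_parabolic S m X = generate (artin_group S m) (artin_gen S m ` X)"

definition conj_subgroup :: "('g, 'b) monoid_scheme \<Rightarrow> 'g \<Rightarrow> 'g set \<Rightarrow> 'g set" where
  "conj_subgroup G g H = (g <#\<^bsub>G\<^esub> H) #>\<^bsub>G\<^esub> inv\<^bsub>G\<^esub> g"

definition parabolic :: "'a set \<Rightarrow> 'a labels \<Rightarrow> 'a word set set \<Rightarrow> bool" where
  "parabolic S m P \<longleftrightarrow>
     (\<exists>g\<in>carrier (artin_group S m). \<exists>X\<subseteq>S.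
        P = conj_subgroup (artin_group S m) g (std_parabolic S m X))"

section \<open>Ordinary retractions and property C\<close>

definition odd_odd_free :: "'a set \<Rightarrow> 'a labels \<Rightarrow> bool" where
  "odd_odd_free S m \<longleftrightarrow>
     \<not> (\<exists>s\<in>S. \<exists>t\<in>S. \<exists>t'\<in>S. t \<noteq> t' \<and> odd_label m s t \<and> odd_label m s t')"

text \<open>By (odd, odd)-freeness the vertex \<open>a\<close> in the second clause is determined by \<open>v\<close>.\<close>

definition ordinary_retraction ::
    "'a set \<Rightarrow> 'a labels \<Rightarrow> 'a set \<Rightarrow> ('a word set \<Rightarrow> 'a word set) \<Rightarrow> bool" where
  "ordinary_retraction S m X \<rho> \<longleftrightarrow>
     \<rho> \<in> hom (artin_group S m) ((artin_group S m)\<lparr>carrier := std_parabolic S m X\<rparr>) \<and>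
     (\<forall>x\<in>X. \<rho> (artin_gen S m x) = artin_gen S m x) \<and>
     (\<forall>v\<in>S - X. \<forall>a\<in>X. odd_label m v a \<longrightarrow> \<rho> (artin_gen S m v) = artin_gen S m a) \<and>
     (\<forall>v\<in>S - X. (\<forall>a\<in>X. \<not> odd_label m v a) \<longrightarrow> \<rho> (artin_gen S m v) = \<one>\<^bsub>artin_group S m\<^esub>)"

definition admits_ordinary_retractions :: "'a set \<Rightarrow> 'a labels \<Rightarrow> bool" where
  "admits_ordinary_retractions S m \<longleftrightarrow> (\<forall>X\<subseteq>S. \<exists>\<rho>. ordinary_retraction S m X \<rho>)"

definition odd_part :: "'a labels \<Rightarrow> 'a set \<Rightarrow> 'a set \<Rightarrow> 'a set" where
  "odd_part m X Y = {x \<in> X - Y. \<exists>y\<in>Y - X. odd_label m x y}"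

definition core :: "'a labels \<Rightarrow> 'a set \<Rightarrow> 'a set \<Rightarrow> 'a set" where
  "core m X Y = (X \<inter> Y) \<union> odd_part m X Y"

definition artin_star :: "'a set \<Rightarrow> 'a labels \<Rightarrow> 'a \<Rightarrow> 'a set" where
  "artin_star S m x = {x} \<union> {t \<in> S - {x}. m x t \<noteq> \<infinity>}"

text \<open>A family is a set of pairs \<open>(S, m)\<close>.  A subgraph of \<open>(S, m)\<close> is represented in the family
  by any pair \<open>(T, m')\<close> whose labels agree with \<open>m\<close> on distinct elements of \<open>T\<close>.\<close>

definition odd_odd_free_family :: "('a set \<times> 'a labels) set \<Rightarrow> bool" where
  "odd_odd_free_family \<F> \<longleftrightarrow> (\<forall>(S, m)\<in>\<F>. artin_labels S m \<and> odd_odd_free S m)"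

definition closed_under_subgraphs :: "('a set \<times> 'a labels) set \<Rightarrow> bool" where
  "closed_under_subgraphs \<F> \<longleftrightarrow>
     (\<forall>(S, m)\<in>\<F>. \<forall>T\<subseteq>S. \<exists>m'. (T, m') \<in> \<F> \<and> (\<forall>s\<in>T. \<forall>t\<in>T. s \<noteq> t \<longrightarrow> m' s t = m s t))"

definition star_condition :: "'a set \<Rightarrow> 'a labels \<Rightarrow> bool" where
  "star_condition S m \<longleftrightarrow>
     (\<forall>X\<subseteq>S. \<forall>Y\<subseteq>S. \<forall>g\<in>carrier (artin_group S m).
        (\<forall>x\<in>S - (core m X Y \<union> core m Y X). artin_star S m x = S) \<longrightarrow>
        std_parabolic S m (core m X Y)
          = conj_subgroup (artin_group S m) g (std_parabolic S m (core m Y X)) \<or>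
        (\<exists>d\<in>carrier (artin_group S m). \<exists>H. (H \<subset> core m X Y \<or> H \<subset> core m Y X) \<and>
           std_parabolic S m (core m X Y)
               \<inter> conj_subgroup (artin_group S m) g (std_parabolic S m (core m Y X))
             \<subseteq> conj_subgroup (artin_group S m) d (std_parabolic S m H)))"

definition property_C :: "('a set \<times> 'a labels) set \<Rightarrow> bool" where
  "property_C \<F> \<longleftrightarrow>
     (\<forall>(S, m)\<in>\<F>. admits_ordinary_retractions S m) \<and>
     closed_under_subgraphs \<F> \<and>
     (\<forall>(S, m)\<in>\<F>. star_condition S m)"

end

theory Submission
  imports Defs "HOL-Algebra.Bij" Complex_Main
begin

text \<open>Retracting \<open>A\<^sub>X \<inter> g A\<^sub>Y g\<^sup>-\<^sup>1\<close> to \<open>A\<^sub>X\<close> and to \<open>A\<^sub>Y\<close> replaces \<open>X\<close> and \<open>Y\<close> by the two cores, which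
  have the same number of elements.  Induct on \<open>|S|\<close>, and then on \<open>|X|\<close>.  If some \<open>x\<close> outside the cores
  has \<open>Star x \<noteq> S\<close>, then \<open>A\<^sub>S\<close> is an amalgamated product of its subgroups on \<open>S - {x}\<close> and \<open>Star x\<close>; in
  its Bass--Serre tree the intersection fixes a path, and it is computed by finitely many
  intersections inside vertex stabilizers, which are Artin groups on fewer generators.  Otherwise
  property C applies: either the intersection is all of the core subgroup, or it lies in a conjugate
  of some \<open>A\<^sub>H\<close> with \<open>|H| < |X|\<close>, and intersecting with that conjugate first reduces \<open>|X|\<close>.

  That a subset \<open>T\<close> of \<open>S\<close> generates a copy of the Artin group on \<open>T\<close> follows from the existence of
  retractions: applied to triples they force the divisibility relations between labels that make
  the ordinary retraction formula define a homomorphism into the abstract Artin group on \<open>T\<close>.\<close>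

section \<open>Homomorphisms out of Artin groups\<close>

primrec word_value :: "('g, 'b) monoid_scheme \<Rightarrow> ('a \<Rightarrow> 'g) \<Rightarrow> 'a word \<Rightarrow> 'g" where
  "word_value H f [] = \<one>\<^bsub>H\<^esub>"
| "word_value H f (l # w) = (if snd l then f (fst l) else inv\<^bsub>H\<^esub> f (fst l)) \<otimes>\<^bsub>H\<^esub> word_value H f w"

fun altprod :: "('g, 'b) monoid_scheme \<Rightarrow> 'g \<Rightarrow> 'g \<Rightarrow> nat \<Rightarrow> 'g" where
  "altprod G x y 0 = \<one>\<^bsub>G\<^esub>"
| "altprod G x y (Suc k) = x \<otimes>\<^bsub>G\<^esub> altprod G y x k"

lemma alternating_0: "alternating s t 0 = []"
  by (simp add: alternating_def)

lemma alternating_Suc: "alternating s t (Suc k) = (s, True) # alternating t s k"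
proof -
  have "[0..<Suc k] = 0 # map Suc [0..<k]"
    by (simp add: upt_conv_Cons map_Suc_upt del: upt_Suc)
  then show ?thesis
    by (simp add: alternating_def del: upt_Suc)
qed

lemma alternating_in_words: "s \<in> S \<Longrightarrow> t \<in> S \<Longrightarrow> alternating s t k \<in> words S"
  by (auto simp: alternating_def words_def)

lemma artin_relations_words: "artin_relations S m \<subseteq> words S \<times> words S"
  by (auto simp: artin_relations_def alternating_in_words)

context group begin

lemma word_value_closed:
  "f \<in> S \<rightarrow> carrier G \<Longrightarrow> w \<in> words S \<Longrightarrow> word_value G f w \<in> carrier G"
  by (induction w) (auto simp: words_def Pi_iff intro!: m_closed inv_closed)

lemma word_value_append:
  "f \<in> S \<rightarrow> carrier G \<Longrightarrow> u \<in> words S \<Longrightarrow> v \<in> words S \<Longrightarrow>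
    word_value G f (u @ v) = word_value G f u \<otimes> word_value G f v"
proof (induction u)
  case Nil
  then show ?case using word_value_closed[of f S v] by simp
next
  case (Cons l u)
  then have u: "u \<in> words S" and l: "f (fst l) \<in> carrier G"
    by (auto simp: words_def)
  show ?case
    using Cons.IH[OF Cons.prems(1) u Cons.prems(3)] l Cons.prems(1,3) u
    by (simp add: m_assoc word_value_closed[of f S])
qed

lemma word_value_pres_eq:
  assumes f: "f \<in> S \<rightarrow> carrier G" and R: "R \<subseteq> words S \<times> words S"
    and rel: "\<And>u v. (u, v) \<in> R \<Longrightarrow> word_value G f u = word_value G f v"
    and "pres_eq S R u v"
  shows "word_value G f u = word_value G f v"
  using assms(4)
proof (induction rule: pres_eq.induct)
  case (app u u' v v')
  then show ?case
    using pres_eq_words[OF R] f by (metis word_value_append)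
next
  case (cancel x b)
  then have "f x \<in> carrier G" using f by auto
  then show ?case by simp
qed (auto simp: rel)

lemma altprod_closed: "x \<in> carrier G \<Longrightarrow> y \<in> carrier G \<Longrightarrow> altprod G x y k \<in> carrier G"
  by (induction k arbitrary: x y) auto

lemma word_value_alternating:
  "word_value G f (alternating s t k) = altprod G (f s) (f t) k"
  by (induction k arbitrary: s t) (simp_all add: alternating_0 alternating_Suc)

lemma altprod_add:
  assumes "x \<in> carrier G" "y \<in> carrier G"
  shows "altprod G x y (j + k)
    = altprod G x y j \<otimes> (if even j then altprod G x y k else altprod G y x k)"
  using assms by (induction j arbitrary: x y) (auto simp: altprod_closed m_assoc)

text \<open>Split both products into blocks of length \<open>n\<close>. For odd \<open>n\<close> the
  first letter changes from block to block, but on both sides at once. This applies when a relation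
  of length \<open>k\<close> is mapped to generators whose label only divides
  \<open>k\<close>.\<close>

lemma altprod_commute_mult:
  assumes "x \<in> carrier G" "y \<in> carrier G" "altprod G x y n = altprod G y x n"
  shows "altprod G x y (n * j) = altprod G y x (n * j)"
  using assms by (induction j) (auto simp: altprod_add)

text \<open>With even length, \<open>x\<close> occurs \<open>j\<close> times on either side. Hence
  even relations survive when a retraction kills one of the two generators.\<close>

lemma altprod_one_even:
  assumes "x \<in> carrier G"
  shows "altprod G x \<one> (2 * j) = altprod G \<one> x (2 * j)"
  using assms by (induction j) (auto simp: altprod_closed)

end

lemma (in group_hom) altprod_hom:
  "x \<in> carrier G \<Longrightarrow> y \<in> carrier G \<Longrightarrow> h (altprod G x y k) = altprod H (h x) (h y) k"
  by (induction k arbitrary: x y) (auto simp: G.altprod_closed)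

text \<open>Von Dyck's theorem. The homomorphism evaluates an arbitrary member of a class;
  \<open>word_value_pres_eq\<close> makes the choice immaterial.\<close>

lemma presented_group_hom_exists:
  assumes H: "group H" and f: "f \<in> S \<rightarrow> carrier H" and R: "R \<subseteq> words S \<times> words S"
    and rel: "\<And>u v. (u, v) \<in> R \<Longrightarrow> word_value H f u = word_value H f v"
  shows "\<exists>\<phi>\<in>hom (presented_group S R) H. \<forall>w\<in>words S. \<phi> (pres_class S R w) = word_value H f w"
proof -
  interpret H: group H by (rule H)
  define \<phi> where "\<phi> = (\<lambda>A. word_value H f (SOME w. w \<in> A))"
  have val: "\<phi> (pres_class S R w) = word_value H f w" if w: "w \<in> words S" for w
  proof -
    have "w \<in> pres_class S R w"
      using w by (simp add: pres_class_def pres_eq.refl)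
    then have "(SOME v. v \<in> pres_class S R w) \<in> pres_class S R w"
      by (rule someI)
    then have "pres_eq S R w (SOME v. v \<in> pres_class S R w)"
      by (simp add: pres_class_def)
    then show ?thesis
      unfolding \<phi>_def using H.word_value_pres_eq[OF f R rel] by metis
  qed
  have "\<phi> \<in> hom (presented_group S R) H"
  proof (rule homI)
    fix x assume "x \<in> carrier (presented_group S R)"
    then show "\<phi> x \<in> carrier H"
      by (auto simp: presented_group_def val H.word_value_closed[OF f])
  next
    fix x y assume "x \<in> carrier (presented_group S R)" "y \<in> carrier (presented_group S R)"
    then obtain u v where "u \<in> words S" "v \<in> words S" "x = pres_class S R u" "y = pres_class S R v"
      by (auto simp: presented_group_def)
    moreover from this have "u @ v \<in> words S" by (simp add: words_def)
    ultimately show "\<phi> (x \<otimes>\<^bsub>presented_group S R\<^esub> y) = \<phi> x \<otimes>\<^bsub>H\<^esub> \<phi> y"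
      using f by (simp add: presented_group_mult val H.word_value_append)
  qed
  with val show ?thesis by blast
qed

lemma artin_gen_closed: "s \<in> S \<Longrightarrow> artin_gen S m s \<in> carrier (artin_group S m)"
  by (auto simp: artin_gen_def artin_group_def presented_group_def words_def)

lemma artin_hom_exists:
  assumes H: "group H" and f: "f \<in> S \<rightarrow> carrier H"
    and rel: "\<And>s t k. s \<in> S \<Longrightarrow> t \<in> S \<Longrightarrow> s \<noteq> t \<Longrightarrow> m s t = enat k \<Longrightarrow>
      altprod H (f s) (f t) k = altprod H (f t) (f s) k"
  shows "\<exists>\<phi>\<in>hom (artin_group S m) H. \<forall>s\<in>S. \<phi> (artin_gen S m s) = f s"
proof -
  interpret H: group H by (rule H)
  have "\<exists>\<phi>\<in>hom (artin_group S m) H.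
      \<forall>w\<in>words S. \<phi> (pres_class S (artin_relations S m) w) = word_value H f w"
    unfolding artin_group_def using H f artin_relations_words
    by (rule presented_group_hom_exists)
      (use rel in \<open>auto simp: artin_relations_def H.word_value_alternating\<close>)
  then obtain \<phi> where \<phi>: "\<phi> \<in> hom (artin_group S m) H"
    "\<forall>w\<in>words S. \<phi> (pres_class S (artin_relations S m) w) = word_value H f w" ..
  have "\<phi> (artin_gen S m s) = f s" if s: "s \<in> S" for s
  proof -
    have "f s \<in> carrier H" using f s by auto
    then show ?thesis
      using \<phi>(2) s by (simp add: artin_gen_def words_def)
  qed
  then show ?thesis using \<phi>(1) by blast
qed

lemma std_parabolic_carrier: "std_parabolic S m S = carrier (artin_group S m)"
proof -
  let ?G = "artin_group S m"
  interpret group ?G by (rule group_artin_group)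
  have gens: "artin_gen S m ` S \<subseteq> carrier ?G"
    using artin_gen_closed by auto
  have "pres_class S (artin_relations S m) w \<in> std_parabolic S m S" if "w \<in> words S" for w
    using that
  proof (induction w)
    case Nil
    then show ?case
      using generate.one[of ?G] by (simp add: std_parabolic_def artin_group_def presented_group_def)
  next
    case (Cons l w)
    let ?c = "pres_class S (artin_relations S m)"
    obtain x b where l: "l = (x, b)" by fastforce
    have x: "x \<in> S" "w \<in> words S" using Cons.prems l by (auto simp: words_def)
    have ws: "[(x, b)] \<in> words S" for b using x by (auto simp: words_def)
    have "?c [(x, False)] \<otimes>\<^bsub>?G\<^esub> artin_gen S m x = ?c ([(x, False)] @ [(x, True)])"
      unfolding artin_group_def artin_gen_def by (rule presented_group_mult[OF ws ws])
    also have "\<dots> = \<one>\<^bsub>?G\<^esub>"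
    proof -
      have "pres_eq S (artin_relations S m) [(x, False), (x, \<not> False)] []"
        by (rule pres_eq.cancel[OF x(1)])
      then show ?thesis
        using ws pres_class_eq_iff[of "[(x, False), (x, True)]" S]
        by (simp add: artin_group_def presented_group_def words_def)
    qed
    finally have inv: "?c [(x, False)] = inv\<^bsub>?G\<^esub> artin_gen S m x"
      using ws artin_gen_closed[OF x(1), of m]
      by (intro inv_equality[symmetric]) (auto simp: artin_group_def presented_group_def)
    have "?c [(x, b)] \<in> std_parabolic S m S"
    proof (cases b)
      case True
      then show ?thesis
        using x by (auto simp: std_parabolic_def artin_gen_def intro!: generate.incl)
    next
      case False
      then show ?thesis
        using x inv by (auto simp: std_parabolic_def intro!: generate.inv)
    qed
    moreover have "?c (l # w) = ?c [(x, b)] \<otimes>\<^bsub>?G\<^esub> ?c w"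
      unfolding artin_group_def using presented_group_mult[OF ws[of b] x(2)] l by simp
    ultimately show ?case
      using Cons.IH[OF x(2)] by (simp add: std_parabolic_def generate.eng)
  qed
  moreover have "std_parabolic S m S \<subseteq> carrier ?G"
    unfolding std_parabolic_def by (rule generate_incl[OF gens])
  ultimately show ?thesis
    by (auto simp: artin_group_def presented_group_def)
qed

lemma artin_relation:
  assumes "s \<in> S" "t \<in> S" "s \<noteq> t" "m s t = enat k"
  shows "altprod (artin_group S m) (artin_gen S m s) (artin_gen S m t) k
    = altprod (artin_group S m) (artin_gen S m t) (artin_gen S m s) k"
proof -
  let ?c = "pres_class S (artin_relations S m)"
  have *: "?c (alternating s t j) = altprod (artin_group S m) (artin_gen S m s) (artin_gen S m t) j"
    if "s \<in> S" "t \<in> S" for s t j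
    using that
  proof (induction j arbitrary: s t)
    case 0
    then show ?case by (simp add: alternating_0 artin_group_def presented_group_def)
  next
    case (Suc j)
    have "[(s, True)] \<in> words S" using Suc.prems by (simp add: words_def)
    from presented_group_mult[OF this alternating_in_words[OF Suc.prems(2,1), of j],
        of "artin_relations S m"]
    show ?case
      using Suc.IH[OF Suc.prems(2,1)] by (simp add: alternating_Suc artin_group_def artin_gen_def)
  qed
  have "pres_eq S (artin_relations S m) (alternating s t k) (alternating t s k)"
    using assms by (intro pres_eq.rel) (auto simp: artin_relations_def)
  then show ?thesis
    using assms by (metis * pres_class_eq_iff alternating_in_words)
qed

lemma artin_homs_eq:
  assumes "group H" "\<phi> \<in> hom (artin_group S m) H" "\<psi> \<in> hom (artin_group S m) H"
    and "\<And>s. s \<in> S \<Longrightarrow> \<phi> (artin_gen S m s) = \<psi> (artin_gen S m s)"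
    and "g \<in> carrier (artin_group S m)"
  shows "\<phi> g = \<psi> g"
proof -
  interpret P: group_hom "artin_group S m" H \<phi>
    using assms group_artin_group by (simp add: group_hom_def group_hom_axioms_def)
  interpret Q: group_hom "artin_group S m" H \<psi>
    using assms group_artin_group by (simp add: group_hom_def group_hom_axioms_def)
  have gen: "generate (artin_group S m) (artin_gen S m ` S) = carrier (artin_group S m)"
    using std_parabolic_carrier[of S m] by (simp add: std_parabolic_def)
  with assms(5) have "g \<in> generate (artin_group S m) (artin_gen S m ` S)"
    by simp
  then show ?thesis
  proof (induction rule: generate.induct)
    case (eng h1 h2)
    then show ?case by (simp add: gen)
  qed (auto simp: assms artin_gen_closed)
qed

section \<open>The order of a product of two generators\<close>

text \<open>The dual of the geometric representation of the Coxeter group, in coordinates.\<close>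

definition reflect :: "('a \<Rightarrow> 'a \<Rightarrow> nat) \<Rightarrow> 'a \<Rightarrow> ('a \<Rightarrow> real) \<Rightarrow> 'a \<Rightarrow> real" where
  "reflect L s f = (\<lambda>u. if u = s then - f s else f u + 2 * cos (pi / real (L s u)) * f s)"

fun alt_reflect :: "('a \<Rightarrow> 'a \<Rightarrow> nat) \<Rightarrow> 'a \<Rightarrow> 'a \<Rightarrow> nat \<Rightarrow> ('a \<Rightarrow> real) \<Rightarrow> 'a \<Rightarrow> real" where
  "alt_reflect L s t 0 f = f"
| "alt_reflect L s t (Suc k) f = reflect L s (alt_reflect L t s k f)"

lemma reflect_involution: "reflect L s (reflect L s f) = f"
  by (auto simp: reflect_def fun_eq_iff)

lemma sin_pi_div_pos:
  assumes "2 \<le> n" shows "0 < sin (pi / real n)"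
proof (rule sin_gt_zero)
  have "pi * 1 < pi * real n" using assms by (intro mult_strict_left_mono) auto
  then show "pi / real n < pi" using assms by (simp add: divide_less_eq)
qed (use assms in simp)

text \<open>A closed form from the Chebyshev recurrence for sines, multiplied by
  \<open>sin \<theta>\<close> to avoid division. The outermost reflection is always that of
  \<open>s\<close>; the parity of \<open>k\<close> tells which one acts first.\<close>

lemma alt_reflect_plane:
  assumes "s \<noteq> t" "L s t = n" "L t s = n"
  defines "\<theta> \<equiv> pi / real n"
  shows "sin \<theta> * alt_reflect L s t k f t =
      (if odd k then f s * sin ((real k + 1) * \<theta>) + f t * sin (real k * \<theta>)
       else f t * sin ((real k + 1) * \<theta>) + f s * sin (real k * \<theta>)) \<and>
    sin \<theta> * alt_reflect L s t k f s =
      - (if odd k then f s * sin (real k * \<theta>) + f t * sin ((real k - 1) * \<theta>)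
       else f t * sin (real k * \<theta>) + f s * sin ((real k - 1) * \<theta>))"
  using assms(1-3)
proof (induction k arbitrary: s t)
  case 0
  then show ?case by simp
next
  case (Suc k)
  \<comment> \<open>The addition formula in the shape of a three-term recurrence in
    \<open>k\<close>.\<close>
  have rec: "2 * cos \<theta> * sin x - sin (x - \<theta>) = sin (x + \<theta>)" for x
    by (simp add: sin_add sin_diff)
  have step: "2 * cos \<theta> * sin ((real k + 1) * \<theta>) - sin (real k * \<theta>) = sin ((real k + 2) * \<theta>)"
    "2 * cos \<theta> * sin (real k * \<theta>) - sin ((real k - 1) * \<theta>) = sin ((real k + 1) * \<theta>)"
    using rec[of "(real k + 1) * \<theta>"] rec[of "real k * \<theta>"]
    by (simp_all add: distrib_right left_diff_distrib add.commute)
  have IH: "sin \<theta> * alt_reflect L t s k f s =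
      (if odd k then f t * sin ((real k + 1) * \<theta>) + f s * sin (real k * \<theta>)
       else f s * sin ((real k + 1) * \<theta>) + f t * sin (real k * \<theta>))"
    "sin \<theta> * alt_reflect L t s k f t =
      - (if odd k then f t * sin (real k * \<theta>) + f s * sin ((real k - 1) * \<theta>)
       else f s * sin (real k * \<theta>) + f t * sin ((real k - 1) * \<theta>))"
    using Suc.IH[of t s] Suc.prems by auto
  have "sin \<theta> * alt_reflect L s t (Suc k) f s = - (sin \<theta> * alt_reflect L t s k f s)"
    by (simp add: reflect_def)
  moreover have "sin \<theta> * alt_reflect L s t (Suc k) f t
      = sin \<theta> * alt_reflect L t s k f t + 2 * cos \<theta> * (sin \<theta> * alt_reflect L t s k f s)"
    using Suc.prems by (simp add: reflect_def \<theta>_def algebra_simps)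
  moreover have "(real (Suc k) + 1) * \<theta> = (real k + 2) * \<theta>" "real (Suc k) * \<theta> = (real k + 1) * \<theta>"
    "(real (Suc k) - 1) * \<theta> = real k * \<theta>"
    by simp_all
  ultimately show ?case
    unfolding IH by (simp only: step[symmetric] even_Suc split: if_split) (simp add: algebra_simps)
qed

text \<open>Off the plane of \<open>s\<close> and \<open>t\<close> nothing has to be computed: since \<open>cos (pi / n)\<^sup>2 \<noteq> 1\<close>, the
  coordinate at \<open>u\<close> plus a suitable combination of those at \<open>s\<close> and \<open>t\<close> is invariant.\<close>

lemma alt_reflect_invariant:
  assumes "s \<noteq> t" "u \<noteq> s" "u \<noteq> t" "L s t = n" "L t s = n" "2 \<le> n"
  shows "\<exists>\<alpha> \<beta>. \<forall>k f. alt_reflect L s t k f u + \<alpha> * alt_reflect L s t k f s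
      + \<beta> * alt_reflect L s t k f t = f u + \<alpha> * f s + \<beta> * f t \<and>
    alt_reflect L t s k f u + \<alpha> * alt_reflect L t s k f s
      + \<beta> * alt_reflect L t s k f t = f u + \<alpha> * f s + \<beta> * f t"
proof -
  define c where "c = 2 * cos (pi / real n)"
  define a where "a = 2 * cos (pi / real (L s u))"
  define b where "b = 2 * cos (pi / real (L t u))"
  have "4 - c\<^sup>2 = 4 * (sin (pi / real n))\<^sup>2"
    by (simp add: c_def power_mult_distrib sin_squared_eq)
  moreover have "sin (pi / real n) \<noteq> 0"
    using sin_pi_div_pos[OF \<open>2 \<le> n\<close>] by simp
  ultimately have d: "4 - c\<^sup>2 \<noteq> 0" by simp
  \<comment> \<open>Invariance under both reflections is the linear system \<open>eqs\<close> below;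
    these values solve it by Cramer's rule, with determinant \<open>4 - c\<^sup>2\<close>.\<close>
  define \<alpha> where "\<alpha> = (2 * a + b * c) / (4 - c\<^sup>2)"
  define \<beta> where "\<beta> = (2 * b + a * c) / (4 - c\<^sup>2)"
  have "(4 - c\<^sup>2) * (a - 2 * \<alpha> + \<beta> * c) = 0" "(4 - c\<^sup>2) * (b - 2 * \<beta> + \<alpha> * c) = 0"
    using d by (simp_all add: \<alpha>_def \<beta>_def field_simps power2_eq_square)
  with d have eqs: "a = 2 * \<alpha> - \<beta> * c" "b = 2 * \<beta> - \<alpha> * c" by auto
  define I where "I f = f u + \<alpha> * f s + \<beta> * f t" for f :: "'a \<Rightarrow> real"
  have "I (reflect L s f) = I f" for f
  proof -
    have "I (reflect L s f) = f u + a * f s - \<alpha> * f s + \<beta> * (f t + c * f s)"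
      using assms by (simp add: I_def reflect_def a_def c_def)
    then show ?thesis unfolding eqs by (simp add: I_def algebra_simps)
  qed
  moreover have "I (reflect L t f) = I f" for f
  proof -
    have "I (reflect L t f) = f u + b * f t - \<beta> * f t + \<alpha> * (f s + c * f t)"
      using assms by (simp add: I_def reflect_def b_def c_def)
    then show ?thesis unfolding eqs by (simp add: I_def algebra_simps)
  qed
  ultimately have "I (alt_reflect L s t k f) = I f \<and> I (alt_reflect L t s k f) = I f" for k f
    by (induction k) auto
  then show ?thesis unfolding I_def by blast
qed

text \<open>For \<open>k = n\<close> the angle \<open>n * \<theta>\<close> is \<open>pi\<close>, so
  both closed forms reduce to the same multiples of \<open>sin \<theta>\<close>. The remaining
  coordinates follow from the invariant combination.\<close>

lemma alt_reflect_commute: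
  assumes "s \<noteq> t" "L s t = n" "L t s = n" "2 \<le> n"
  shows "alt_reflect L s t n f = alt_reflect L t s n f"
proof
  fix u
  define \<theta> where "\<theta> = pi / real n"
  have pi: "real n * \<theta> = pi" using assms by (simp add: \<theta>_def)
  have "sin ((real n + 1) * \<theta>) = - sin \<theta>" "sin ((real n - 1) * \<theta>) = sin \<theta>" "sin (real n * \<theta>) = 0"
    using pi by (simp_all add: distrib_right left_diff_distrib)
  moreover have "sin \<theta> \<noteq> 0" using sin_pi_div_pos[OF \<open>2 \<le> n\<close>] by (simp add: \<theta>_def)
  moreover from calculation have
    "sin \<theta> * alt_reflect L s t n f s = sin \<theta> * alt_reflect L t s n f s"
    "sin \<theta> * alt_reflect L s t n f t = sin \<theta> * alt_reflect L t s n f t"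
    using alt_reflect_plane[OF assms(1-3), of n f] alt_reflect_plane[of t s L n n f] assms
    unfolding \<theta>_def[symmetric] by simp_all
  ultimately have plane: "alt_reflect L s t n f s = alt_reflect L t s n f s"
    "alt_reflect L s t n f t = alt_reflect L t s n f t"
    by simp_all
  show "alt_reflect L s t n f u = alt_reflect L t s n f u"
  proof (cases "u = s \<or> u = t")
    case True
    then show ?thesis using plane by auto
  next
    case False
    then obtain \<alpha> \<beta> where "\<forall>k f. alt_reflect L s t k f u + \<alpha> * alt_reflect L s t k f s
      + \<beta> * alt_reflect L s t k f t = f u + \<alpha> * f s + \<beta> * f t \<and>
    alt_reflect L t s k f u + \<alpha> * alt_reflect L t s k f s
      + \<beta> * alt_reflect L t s k f t = f u + \<alpha> * f s + \<beta> * f t"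
      using alt_reflect_invariant[of s t u L n] assms by blast
    from spec[OF spec[OF this, of n], of f] show ?thesis using plane by simp
  qed
qed

text \<open>Equality of the two products forces \<open>sin (k * \<theta>) = 0\<close>, so
  \<open>k / n\<close> is an integer.\<close>

lemma alt_reflect_order:
  assumes "s \<noteq> t" "L s t = n" "L t s = n" "2 \<le> n"
    and eq: "\<And>f. alt_reflect L s t k f = alt_reflect L t s k f"
  shows "n dvd k"
proof -
  define \<theta> where "\<theta> = pi / real n"
  \<comment> \<open>On this unit vector the two closed forms differ by a sign: both are plus or
    minus \<open>sin (k * \<theta>)\<close>, at \<open>s\<close> for odd \<open>k\<close> and at
    \<open>t\<close> for even \<open>k\<close>.\<close>
  define f where "f = (\<lambda>u. if u = s then 1 else 0 :: real)"
  have f: "f s = 1" "f t = 0" using assms by (auto simp: f_def)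
  have "sin \<theta> * alt_reflect L s t k f s = sin \<theta> * alt_reflect L t s k f s"
    "sin \<theta> * alt_reflect L s t k f t = sin \<theta> * alt_reflect L t s k f t"
    using eq by auto
  then have "sin (real k * \<theta>) = 0"
    using alt_reflect_plane[OF assms(1-3), of k f] alt_reflect_plane[of t s L n k f] assms f
    unfolding \<theta>_def[symmetric]
    by (auto split: if_splits)
  then obtain i :: int where "real k * \<theta> = of_int i * pi"
    by (auto simp: sin_zero_iff_int2)
  then have "real k = of_int i * real n"
    using assms by (simp add: \<theta>_def field_simps)
  then have "int k = i * int n"
    by (metis of_int_eq_iff of_int_mult of_int_of_nat_eq)
  then show ?thesis
    by (metis dvd_triv_right int_dvd_int_iff)
qed

text \<open>The reflections satisfy the Artin relations and so give an action of the Artin group. In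
  that action the alternating products agree only in lengths divisible by the label.\<close>

lemma altprod_gen_eq_dvd:
  assumes lab: "artin_labels S m" and ab: "a \<in> S" "b \<in> S" "a \<noteq> b" and k: "0 < k"
    and eq: "altprod (artin_group S m) (artin_gen S m a) (artin_gen S m b) k
      = altprod (artin_group S m) (artin_gen S m b) (artin_gen S m a) k"
  shows "\<exists>n. m a b = enat n \<and> n dvd k"
proof -
  \<comment> \<open>an infinite label may be replaced by any finite one not dividing \<open>k\<close>\<close>
  define L where "L = (\<lambda>s t. case m s t of enat n \<Rightarrow> n | \<infinity> \<Rightarrow> k + 1)"
  have L: "L s t = L t s \<and> 2 \<le> L s t" if "s \<in> S" "t \<in> S" "s \<noteq> t" for s t
  proof -
    have "m s t = m t s" "2 \<le> m s t" using lab that by (auto simp: artin_labels_def)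
    then show ?thesis using k by (cases "m t s") (auto simp: L_def numeral_eq_enat)
  qed
  define r where "r = reflect L"
  let ?H = "BijGroup (UNIV :: ('a \<Rightarrow> real) set)"
  have r: "r s \<in> carrier ?H" for s
    using involuntory_imp_bij[of "reflect L s"]
    by (simp add: BijGroup_def Bij_def r_def reflect_involution)
  have mult: "f \<otimes>\<^bsub>?H\<^esub> g = (\<lambda>x. f (g x))" if "f \<in> carrier ?H" "g \<in> carrier ?H" for f g
    using that by (simp add: BijGroup_def compose_def restrict_UNIV)
  have alt: "altprod ?H (r s) (r t) j = alt_reflect L s t j" for s t j
  proof (induction j arbitrary: s t)
    case 0
    then show ?case by (auto simp: BijGroup_def fun_eq_iff)
  next
    case (Suc j)
    have "altprod ?H (r t) (r s) j \<in> carrier ?H"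
      by (rule group.altprod_closed[OF group_BijGroup r r])
    from mult[OF r[of s] this] show ?case
      unfolding altprod.simps Suc.IH by (simp add: r_def fun_eq_iff)
  qed
  have "\<exists>\<phi>\<in>hom (artin_group S m) ?H. \<forall>s\<in>S. \<phi> (artin_gen S m s) = r s"
  proof (rule artin_hom_exists[OF group_BijGroup])
    fix s t j assume st: "s \<in> S" "t \<in> S" "s \<noteq> t" "m s t = enat j"
    then have "L s t = j" by (simp add: L_def)
    then show "altprod ?H (r s) (r t) j = altprod ?H (r t) (r s) j"
      unfolding alt using alt_reflect_commute[of s t L j] L[of s t] st by auto
  qed (use r in auto)
  then obtain \<phi> where \<phi>: "\<phi> \<in> hom (artin_group S m) ?H" "\<forall>s\<in>S. \<phi> (artin_gen S m s) = r s" ..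
  interpret \<phi>: group_hom "artin_group S m" ?H \<phi>
    by (intro group_hom.intro group_hom_axioms.intro group_artin_group group_BijGroup \<phi>(1))
  have "altprod ?H (r a) (r b) k = altprod ?H (r b) (r a) k"
    using arg_cong[OF eq, of \<phi>] \<phi>(2) ab artin_gen_closed[of _ S m] by (simp add: \<phi>.altprod_hom)
  then have "L a b dvd k"
    unfolding alt using L[of a b] ab by (intro alt_reflect_order[of a b L]) auto
  then show ?thesis
    using k by (cases "m a b") (auto simp: L_def dest: dvd_imp_le)
qed

section \<open>Conjugate subgroups\<close>

context group begin

lemma conj_subgroup_image: "conj_subgroup G g H = (\<lambda>h. g \<otimes> h \<otimes> inv g) ` H"
  by (auto simp: conj_subgroup_def l_coset_def r_coset_def)

lemma conj_subgroup_mono: "H \<subseteq> K \<Longrightarrow> conj_subgroup G g H \<subseteq> conj_subgroup G g K"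
  by (auto simp: conj_subgroup_image)

lemma conj_subgroup_closed:
  "g \<in> carrier G \<Longrightarrow> H \<subseteq> carrier G \<Longrightarrow> conj_subgroup G g H \<subseteq> carrier G"
  by (auto simp: conj_subgroup_image)

lemma conj_subgroup_one: "H \<subseteq> carrier G \<Longrightarrow> conj_subgroup G \<one> H = H"
  by (force simp: conj_subgroup_image image_iff)

lemma conj_subgroup_mult:
  assumes "g \<in> carrier G" "h \<in> carrier G" "H \<subseteq> carrier G"
  shows "conj_subgroup G g (conj_subgroup G h H) = conj_subgroup G (g \<otimes> h) H"
  unfolding conj_subgroup_image image_image
  using assms by (intro image_cong) (auto simp: m_assoc inv_mult_group subset_iff)

lemma conj_subgroup_Int:
  assumes "g \<in> carrier G" "H \<subseteq> carrier G" "K \<subseteq> carrier G"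
  shows "conj_subgroup G g (H \<inter> K) = conj_subgroup G g H \<inter> conj_subgroup G g K"
  unfolding conj_subgroup_image
  using assms by (intro inj_on_image_Int[of _ "carrier G"]) (auto simp: inj_on_def)

lemma conj_subgroup_inv:
  assumes "g \<in> carrier G" "H \<subseteq> carrier G"
  shows "conj_subgroup G (inv g) (conj_subgroup G g H) = H"
    and "conj_subgroup G g (conj_subgroup G (inv g) H) = H"
  using assms by (simp_all add: conj_subgroup_mult conj_subgroup_one)

lemma conj_subgroup_subset:
  assumes "subgroup H G" "g \<in> H" "K \<subseteq> H"
  shows "conj_subgroup G g K \<subseteq> H"
  using assms by (auto simp: conj_subgroup_image intro!: subgroup.m_closed subgroup.m_inv_closed)

end

lemma (in group_hom) conj_subgroup_hom:
  assumes "g \<in> carrier G" "K \<subseteq> carrier G"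
  shows "h ` conj_subgroup G g K = conj_subgroup H (h g) (h ` K)"
  unfolding G.conj_subgroup_image H.conj_subgroup_image image_image
  using assms by (intro image_cong) auto

section \<open>Ordinary retractions\<close>

lemma odd_label_commute:
  "artin_labels S m \<Longrightarrow> s \<in> S \<Longrightarrow> t \<in> S \<Longrightarrow> odd_label m s t \<longleftrightarrow> odd_label m t s"
  by (auto simp: odd_label_def artin_labels_def)

lemma std_parabolic_mono: "X \<subseteq> Y \<Longrightarrow> std_parabolic S m X \<subseteq> std_parabolic S m Y"
  unfolding std_parabolic_def by (intro group.mono_generate group_artin_group image_mono)

lemma artin_gens_closed: "X \<subseteq> S \<Longrightarrow> artin_gen S m ` X \<subseteq> carrier (artin_group S m)"
  by (auto simp: artin_gen_closed subset_iff)

lemma std_parabolic_subgroup: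
  "X \<subseteq> S \<Longrightarrow> subgroup (std_parabolic S m X) (artin_group S m)"
  unfolding std_parabolic_def
  by (intro group.generate_is_subgroup group_artin_group artin_gens_closed)

lemma std_parabolic_closed: "X \<subseteq> S \<Longrightarrow> std_parabolic S m X \<subseteq> carrier (artin_group S m)"
  by (simp add: std_parabolic_subgroup subgroup.subset)

lemma artin_gen_in_std_parabolic: "x \<in> X \<Longrightarrow> artin_gen S m x \<in> std_parabolic S m X"
  by (simp add: std_parabolic_def generate.incl)

lemma ordinary_retractionD:
  assumes "ordinary_retraction S m X \<rho>"
  shows "\<rho> \<in> hom (artin_group S m) ((artin_group S m)\<lparr>carrier := std_parabolic S m X\<rparr>)"
    and "x \<in> X \<Longrightarrow> \<rho> (artin_gen S m x) = artin_gen S m x"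
    and "v \<in> S - X \<Longrightarrow> a \<in> X \<Longrightarrow> odd_label m v a \<Longrightarrow> \<rho> (artin_gen S m v) = artin_gen S m a"
    and "v \<in> S - X \<Longrightarrow> \<forall>a\<in>X. \<not> odd_label m v a \<Longrightarrow> \<rho> (artin_gen S m v) = \<one>\<^bsub>artin_group S m\<^esub>"
  using assms unfolding ordinary_retraction_def by blast+

lemma ordinary_retraction_hom:
  assumes "ordinary_retraction S m X \<rho>" "X \<subseteq> S"
  shows "group_hom (artin_group S m) (artin_group S m) \<rho>"
proof (intro group_hom.intro group_hom_axioms.intro group_artin_group)
  show "\<rho> \<in> hom (artin_group S m) (artin_group S m)"
    using ordinary_retractionD(1)[OF assms(1)] std_parabolic_closed[OF assms(2), of m]
    by (auto simp: hom_def)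
qed

lemma ordinary_retraction_mem:
  assumes "ordinary_retraction S m X \<rho>" "g \<in> carrier (artin_group S m)"
  shows "\<rho> g \<in> std_parabolic S m X"
  using ordinary_retractionD(1)[OF assms(1)] assms(2) by (auto simp: hom_def)

lemma ordinary_retraction_id:
  assumes "ordinary_retraction S m X \<rho>" "X \<subseteq> S" "g \<in> std_parabolic S m X"
  shows "\<rho> g = g"
proof -
  interpret \<rho>: group_hom "artin_group S m" "artin_group S m" \<rho>
    using assms(1,2) by (rule ordinary_retraction_hom)
  have gens: "artin_gen S m ` X \<subseteq> carrier (artin_group S m)"
    using assms(2) by (rule artin_gens_closed)
  have "x \<in> X \<Longrightarrow> \<rho> (artin_gen S m x) = artin_gen S m x" for x
    by (rule ordinary_retractionD(2)[OF assms(1)])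
  with assms(3) show ?thesis
    unfolding std_parabolic_def
    by (induction rule: generate.induct)
       (use gens in \<open>auto simp: \<rho>.G.generate_in_carrier[OF gens]\<close>)
qed

text \<open>This is what \<open>core\<close> is made for. Generators in both sets stay; a generator
  of \<open>Y - X\<close> goes to its odd partner in \<open>X\<close>, which lies either in
  \<open>Y\<close> or in the odd part, or else to the identity.\<close>

lemma ordinary_retraction_std_parabolic:
  assumes lab: "artin_labels S m" and \<rho>: "ordinary_retraction S m X \<rho>" and XY: "X \<subseteq> S" "Y \<subseteq> S"
  shows "\<rho> ` std_parabolic S m Y = std_parabolic S m (core m X Y)"
proof -
  let ?G = "artin_group S m" let ?g = "artin_gen S m"
  interpret \<rho>: group_hom ?G ?G \<rho>
    using \<rho> XY(1) by (rule ordinary_retraction_hom)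
  have fix_on: "\<rho> (?g x) = ?g x" if "x \<in> X" for x
    using that by (rule ordinary_retractionD(2)[OF \<rho>])
  have odd: "\<rho> (?g v) = ?g a" if "v \<in> S - X" "a \<in> X" "odd_label m v a" for v a
    using that by (rule ordinary_retractionD(3)[OF \<rho>])
  have one: "\<rho> (?g v) = \<one>\<^bsub>?G\<^esub>" if "v \<in> S - X" "\<forall>a\<in>X. \<not> odd_label m v a" for v
    using that by (rule ordinary_retractionD(4)[OF \<rho>])
  have core: "core m X Y \<subseteq> S" using XY by (auto simp: core_def odd_part_def)
  have gens: "?g ` Y \<subseteq> carrier ?G" using XY(2) by (rule artin_gens_closed)
  have "\<rho> (?g y) \<in> std_parabolic S m (core m X Y)" if y: "y \<in> Y" for y
  proof (cases "y \<in> X")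
    case True
    then show ?thesis using y by (simp add: fix_on core_def artin_gen_in_std_parabolic)
  next
    case False
    with y XY have yS: "y \<in> S - X" by auto
    show ?thesis
    proof (cases "\<exists>a\<in>X. odd_label m y a")
      case True
      then obtain a where a: "a \<in> X" "odd_label m y a" by blast
      then have "odd_label m a y" using odd_label_commute[OF lab, of a y] yS XY by auto
      then have "a \<in> core m X Y"
        using a y False by (auto simp: core_def odd_part_def)
      then show ?thesis using odd[OF yS a] by (simp add: artin_gen_in_std_parabolic)
    next
      case False
      then have "\<rho> (?g y) = \<one>\<^bsub>?G\<^esub>" using one[OF yS] by blast
      then show ?thesis by (simp add: std_parabolic_def generate.one)
    qed
  qed
  then have "generate ?G (\<rho> ` (?g ` Y)) \<subseteq> std_parabolic S m (core m X Y)"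
    using std_parabolic_subgroup[OF core] by (intro \<rho>.G.generate_subgroup_incl) auto
  moreover have "?g x \<in> \<rho> ` (?g ` Y)" if x: "x \<in> core m X Y" for x
  proof (cases "x \<in> Y")
    case True
    then have "x \<in> X" using x by (auto simp: core_def odd_part_def)
    then have "?g x = \<rho> (?g x)" using fix_on by simp
    then show ?thesis using True by blast
  next
    case False
    then obtain y where y: "x \<in> X" "y \<in> Y - X" "odd_label m x y"
      using x by (auto simp: core_def odd_part_def)
    then have "odd_label m y x" using odd_label_commute[OF lab, of x y] XY by auto
    then have "\<rho> (?g y) = ?g x" using odd[of y x] y XY by auto
    then show ?thesis using y by (metis DiffD1 imageI)
  qed
  then have "std_parabolic S m (core m X Y) \<subseteq> generate ?G (\<rho> ` (?g ` Y))"
    unfolding std_parabolic_def by (intro \<rho>.G.mono_generate) auto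
  ultimately show ?thesis
    using \<rho>.generate_img[OF gens] by (simp add: std_parabolic_def)
qed

text \<open>Closure under subgraphs is kept only in the form of retractions for every subset, with
  the one labelling \<open>m\<close>, so that the inductions need not mention a family.\<close>

locale retractable =
  fixes S :: "'a set" and m :: "'a labels"
  assumes labels: "artin_labels S m" and free: "odd_odd_free S m"
    and retractions: "\<And>T. T \<subseteq> S \<Longrightarrow> admits_ordinary_retractions T m"

lemma retractable_subset:
  assumes "retractable S m" "T \<subseteq> S" shows "retractable T m"
proof
  interpret retractable S m by (rule assms(1))
  show "artin_labels T m"
    using labels assms(2) finite_subset unfolding artin_labels_def by blast
  show "odd_odd_free T m"
    using free assms(2) unfolding odd_odd_free_def by blast
  show "admits_ordinary_retractions U m" if "U \<subseteq> T" for U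
    using that assms(2) by (intro retractions) auto
qed

section \<open>Embedding the Artin group of a subset of the vertices\<close>

context retractable begin

abbreviation "G \<equiv> artin_group S m"

sublocale group G by (rule group_artin_group)

lemma obtain_retraction:
  assumes "X \<subseteq> S" obtains \<rho> where "ordinary_retraction S m X \<rho>"
  using retractions[of S] assms by (auto simp: admits_ordinary_retractions_def)

lemma odd_partner_unique:
  "v \<in> S \<Longrightarrow> a \<in> S \<Longrightarrow> b \<in> S \<Longrightarrow> odd_label m v a \<Longrightarrow> odd_label m v b \<Longrightarrow> a = b"
  using free by (auto simp: odd_odd_free_def)

text \<open>The retraction of the subgroup on \<open>{a, b, v}\<close> onto that on \<open>{a, b}\<close> turns the relation of
  \<open>a\<close> and \<open>v\<close> into one of \<open>a\<close> and \<open>b\<close>.\<close>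

lemma odd_partner_label_dvd:
  assumes "a \<in> S" "b \<in> S" "v \<in> S" "a \<noteq> b" "a \<noteq> v" "odd_label m v b" "m a v = enat k"
  shows "\<exists>n. m a b = enat n \<and> n dvd k"
proof -
  define T where "T = {a, b, v}"
  have T: "T \<subseteq> S" "a \<in> T" "b \<in> T" "v \<in> T" using assms by (auto simp: T_def)
  interpret T: retractable T m
    using retractable_subset retractable_axioms T(1) by blast
  have ab: "{a, b} \<subseteq> T" by (auto simp: T_def)
  obtain \<rho> where \<rho>: "ordinary_retraction T m {a, b} \<rho>"
    using T.obtain_retraction[OF ab] .
  interpret \<rho>: group_hom T.G T.G \<rho>
    using \<rho> ab by (rule ordinary_retraction_hom)
  have "v \<noteq> b" using assms by (auto simp: odd_label_def)
  then have img: "\<rho> (artin_gen T m a) = artin_gen T m a" "\<rho> (artin_gen T m v) = artin_gen T m b"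
    using ordinary_retractionD(2,3)[OF \<rho>] assms T by auto
  have "altprod T.G (artin_gen T m a) (artin_gen T m v) k = altprod T.G (artin_gen T m v) (artin_gen T m a) k"
    using assms T by (intro artin_relation) auto
  then have "altprod T.G (artin_gen T m a) (artin_gen T m b) k = altprod T.G (artin_gen T m b) (artin_gen T m a) k"
    using \<rho>.altprod_hom img artin_gen_closed T by metis
  moreover have "0 < k"
    using labels assms by (fastforce simp: artin_labels_def numeral_eq_enat)
  ultimately show ?thesis
    using T.labels T assms by (intro altprod_gen_eq_dvd) auto
qed

text \<open>The target is the abstract Artin group on \<open>T\<close>, whereas the given
  retractions of \<open>S\<close> only reach the subgroup generated by \<open>T\<close>. The same
  formula on generators is therefore checked against the relations afresh.\<close>

lemma retraction_onto_subsystem: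
  assumes T: "T \<subseteq> S"
  shows "\<exists>r\<in>hom G (artin_group T m). \<forall>v\<in>T. r (artin_gen S m v) = artin_gen T m v"
proof -
  interpret T: retractable T m
    using retractable_subset retractable_axioms T by blast
  \<comment> \<open>\<open>rep v a\<close> says that \<open>v\<close> is to be sent to the generator
    \<open>a\<close>: itself, or its odd partner in \<open>T\<close>. A vertex without such an
    \<open>a\<close> is sent to the identity.\<close>
  define rep where "rep v a \<longleftrightarrow> a \<in> T \<and> (v = a \<or> v \<notin> T \<and> odd_label m v a)" for v a
  define f where "f v = (if \<exists>a. rep v a then artin_gen T m (SOME a. rep v a) else \<one>\<^bsub>T.G\<^esub>)" for v
  have rep_unique: "a = b" if "v \<in> S" "rep v a" "rep v b" for v a b
    using that T odd_partner_unique[of v a b] by (auto simp: rep_def)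
  have f_rep: "f v = artin_gen T m a" if "v \<in> S" "rep v a" for v a
    using rep_unique[OF that] that by (metis f_def someI)
  have f_none: "f v = \<one>\<^bsub>T.G\<^esub>" if "\<nexists>a. rep v a" for v
    using that by (simp add: f_def)
  have f_closed: "f v \<in> carrier T.G" if "v \<in> S" for v
  proof (cases "\<exists>a. rep v a")
    case True
    then obtain a where a: "rep v a" ..
    then have "a \<in> T" by (simp add: rep_def)
    then show ?thesis using f_rep[OF that a] by (simp add: artin_gen_closed)
  qed (simp add: f_none)
  \<comment> \<open>An odd label is impossible here: if \<open>s\<close> is in \<open>T\<close>, it
    would represent \<open>t\<close>; otherwise \<open>t\<close> would be a second odd partner of
    \<open>s\<close>, next to \<open>a\<close>.\<close>
  have one_even: "altprod T.G (f s) (f t) k = altprod T.G (f t) (f s) k"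
    if st: "s \<in> S" "t \<in> S" "s \<noteq> t" "m s t = enat k" and a: "rep s a" and none: "\<nexists>b. rep t b" for s t k a
  proof -
    have "even k"
    proof (rule ccontr)
      assume "odd k"
      then have odd: "odd_label m s t" using st by (simp add: odd_label_def)
      have tT: "t \<notin> T" using none by (auto simp: rep_def)
      show False
      proof (cases "s \<in> T")
        case True
        then show False using none tT odd odd_label_commute[OF labels st(1,2)] by (auto simp: rep_def)
      next
        case False
        then have "a \<in> T" "odd_label m s a" using a by (auto simp: rep_def)
        then show False using odd_partner_unique[of s a t] odd st T tT by auto
      qed
    qed
    then obtain j where "k = 2 * j" by blast
    then show ?thesis
      using T.altprod_one_even[OF f_closed[OF st(1)]] f_none[OF none] by simp
  qed
  have "\<exists>r\<in>hom G T.G. \<forall>v\<in>S. r (artin_gen S m v) = f v"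
  proof (rule artin_hom_exists[OF group_artin_group])
    show "f \<in> S \<rightarrow> carrier T.G" using f_closed by blast
    fix s t k assume st: "s \<in> S" "t \<in> S" "s \<noteq> t" "m s t = enat k"
    have ts: "m t s = enat k" using st labels by (auto simp: artin_labels_def)
    consider "\<nexists>a. rep s a" "\<nexists>b. rep t b" | a where "rep s a" "\<nexists>b. rep t b"
      | b where "\<nexists>a. rep s a" "rep t b" | a b where "rep s a" "rep t b" by blast
    then show "altprod T.G (f s) (f t) k = altprod T.G (f t) (f s) k"
    proof cases
      case 1
      then show ?thesis by (simp add: f_none)
    next
      case (2 a)
      then show ?thesis using one_even st by blast
    next
      case (3 b)
      then show ?thesis using one_even st ts by metis
    next
      case (4 a b)
      have T': "a \<in> T" "b \<in> T" using 4 by (auto simp: rep_def)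
      show ?thesis
      proof (cases "a = b")
        case True
        then show ?thesis using 4 st by (simp add: f_rep)
      next
        case False
        \<comment> \<open>The vertices \<open>s\<close> and \<open>t\<close> are exchanged for their
          representatives one at a time; each exchange replaces the label by a divisor.\<close>
        have "\<exists>n. m a b = enat n \<and> n dvd k"
        proof (cases "t = b")
          case t: True
          show ?thesis
          proof (cases "s = a")
            case True
            then show ?thesis using t st by auto
          next
            case s: False
            then have "\<exists>n. m b a = enat n \<and> n dvd k"
              using odd_partner_label_dvd[of b a s k] 4 t st ts T T' False by (auto simp: rep_def)
            then show ?thesis using labels T T' False by (auto simp: artin_labels_def subset_iff)
          qed
        next
          case t: False
          then have tb: "t \<notin> T" "odd_label m t b" using 4 by (auto simp: rep_def)
          show ?thesis
          proof (cases "s = a")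
            case True
            then show ?thesis
              using odd_partner_label_dvd[of a b t k] tb st T T' False by auto
          next
            case s: False
            then have sa: "s \<notin> T" "odd_label m s a" using 4 by (auto simp: rep_def)
            \<comment> \<open>Both vertices move: first \<open>t\<close> to \<open>b\<close>, giving
              a label \<open>n\<close> of \<open>s\<close> and \<open>b\<close>, then
              \<open>s\<close> to \<open>a\<close>, giving a divisor of \<open>n\<close>.\<close>
            have "s \<noteq> b" using sa T' by auto
            then obtain n where n: "m s b = enat n" "n dvd k"
              using odd_partner_label_dvd[of s b t k] tb st T T' by auto
            then have "m b s = enat n" using labels st T T' \<open>s \<noteq> b\<close> by (auto simp: artin_labels_def)
            then obtain n' where "m b a = enat n'" "n' dvd n"
              using odd_partner_label_dvd[of b a s n] sa st T T' False \<open>s \<noteq> b\<close> by auto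
            then show ?thesis
              using n labels T T' False by (auto simp: artin_labels_def subset_iff intro: dvd_trans)
          qed
        qed
        then obtain n j where "m a b = enat n" "k = n * j" by blast
        then show ?thesis
          using T.altprod_commute_mult[OF _ _ artin_relation[of a T b m n]] T' False 4 st
          by (simp add: f_rep artin_gen_closed)
      qed
    qed
  qed
  moreover have "f v = artin_gen T m v" if "v \<in> T" for v
    using f_rep[of v v] that T by (auto simp: rep_def)
  ultimately show ?thesis
    using T by (metis subsetD)
qed

text \<open>Van der Lek's theorem, in the presence of ordinary retractions.\<close>

lemma subsystem_embedding:
  assumes T: "T \<subseteq> S"
  shows "\<exists>\<iota>. group_hom (artin_group T m) G \<iota> \<and> inj_on \<iota> (carrier (artin_group T m)) \<and>
    (\<forall>X\<subseteq>T. \<iota> ` std_parabolic T m X = std_parabolic S m X)"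
proof -
  let ?H = "artin_group T m"
  have "\<exists>\<iota>\<in>hom ?H G. \<forall>v\<in>T. \<iota> (artin_gen T m v) = artin_gen S m v"
    using subsetD[OF T] artin_gen_closed[of _ S m]
    by (intro artin_hom_exists group_artin_group artin_relation) auto
  then obtain \<iota> where \<iota>: "\<iota> \<in> hom ?H G" "\<forall>v\<in>T. \<iota> (artin_gen T m v) = artin_gen S m v" ..
  interpret \<iota>: group_hom ?H G \<iota>
    by (intro group_hom.intro group_hom_axioms.intro group_artin_group \<iota>)
  obtain r where r: "r \<in> hom G ?H" "\<forall>v\<in>T. r (artin_gen S m v) = artin_gen T m v"
    using retraction_onto_subsystem[OF T] ..
  \<comment> \<open>The composite fixes every generator, so \<open>r\<close> is a left inverse of
    \<open>\<iota>\<close>, and injectivity follows.\<close>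
  have "(r \<circ> \<iota>) g = id g" if "g \<in> carrier ?H" for g
  proof (rule artin_homs_eq[OF group_artin_group _ _ _ that])
    show "r \<circ> \<iota> \<in> hom ?H ?H" using \<iota>(1) r(1) by (rule Group.hom_compose)
    show "id \<in> hom ?H ?H" by (simp add: hom_def)
  qed (use \<iota> r in auto)
  then have "inj_on \<iota> (carrier ?H)"
    by (intro inj_on_inverseI[of _ r]) auto
  moreover have "\<iota> ` std_parabolic T m X = std_parabolic S m X" if X: "X \<subseteq> T" for X
  proof -
    have "artin_gen T m ` X \<subseteq> carrier ?H" using X by (rule artin_gens_closed)
    moreover have "\<iota> ` (artin_gen T m ` X) = artin_gen S m ` X"
      using X \<iota>(2) unfolding image_image by (intro image_cong) auto
    ultimately show ?thesis
      using \<iota>.generate_img by (metis std_parabolic_def)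
  qed
  ultimately show ?thesis using \<iota>.group_hom_axioms by blast
qed

end

section \<open>Amalgamated products\<close>

text \<open>With \<open>n = \<one>\<close> this shows that a set of products exhausts the group once
  generators and their inverses preserve it from the left.\<close>

lemma (in group) generate_left_closed:
  assumes K: "K \<subseteq> carrier G" and N: "N \<subseteq> carrier G"
    and step: "\<And>k n. k \<in> K \<Longrightarrow> n \<in> N \<Longrightarrow> k \<otimes> n \<in> N \<and> inv k \<otimes> n \<in> N"
    and "g \<in> generate G K" "n \<in> N"
  shows "g \<otimes> n \<in> N"
  using assms(4,5)
proof (induction arbitrary: n rule: generate.induct)
  case one
  then show ?case using N by (metis l_one subsetD)
next
  case (eng h1 h2)
  then have "h1 \<otimes> (h2 \<otimes> n) \<in> N" by blast
  moreover have "h1 \<in> carrier G" "h2 \<in> carrier G" "n \<in> carrier G"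
    using eng K N generate_in_carrier by auto
  ultimately show ?case by (simp add: m_assoc)
qed (use step in auto)

text \<open>The universal property of the pushout is required only for actions on sets of normal forms,
  since a locale assumption cannot quantify over the type of the target.\<close>

locale amalgam = group G for G :: "('g, 'b) monoid_scheme" (structure) +
  fixes V :: "bool \<Rightarrow> 'g set"
  assumes factors: "subgroup (V \<sigma>) G"
    and generated: "generate G (V True \<union> V False) = carrier G"
    and extend: "\<And>(\<Omega> :: ('g \<times> (bool \<times> 'g) list) set) act.
      (\<And>\<sigma>. act \<sigma> \<in> hom (G\<lparr>carrier := V \<sigma>\<rparr>) (BijGroup \<Omega>)) \<Longrightarrow>
      (\<And>v. v \<in> V True \<Longrightarrow> v \<in> V False \<Longrightarrow> act True v = act False v) \<Longrightarrow>
      \<exists>\<phi>\<in>hom G (BijGroup \<Omega>). \<forall>\<sigma>. \<forall>v\<in>V \<sigma>. \<phi> v = act \<sigma> v"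
begin

section \<open>Normal forms in an amalgamated product\<close>

definition C :: "'g set" where "C = V True \<inter> V False"

text \<open>Depends only on the right coset of \<open>C\<close>. The coset \<open>C\<close> itself
  is represented by the identity, so that its elements contribute no letter.\<close>

definition coset_rep :: "'g \<Rightarrow> 'g" where
  "coset_rep v = (if v \<in> C then \<one> else SOME t. t \<in> C #> v)"

text \<open>A normal form \<open>(c, [t\<^sub>1, \<dots>, t\<^sub>n])\<close> stands for the product \<open>c t\<^sub>1 \<dots> t\<^sub>n\<close>; as the element of \<open>C\<close>
  is in front, left multiplication by a factor affects only \<open>c\<close> and \<open>t\<^sub>1\<close>.\<close>

definition normal_tails :: "(bool \<times> 'g) list set" where
  "normal_tails = {l. distinct_adj (map fst l) \<and> (\<forall>(\<sigma>, t)\<in>set l. t \<in> V \<sigma> - C \<and> coset_rep t = t)}"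

definition normal_forms :: "('g \<times> (bool \<times> 'g) list) set" where
  "normal_forms = C \<times> normal_tails"

text \<open>The same products with a leading letter from \<open>V \<sigma>\<close> absorbed into the
  first component, where \<open>V \<sigma>\<close> acts by plain left multiplication.
  \<open>fuse\<close> and \<open>normalize\<close> are mutually inverse translations between the two
  kinds of form.\<close>

definition split_forms :: "bool \<Rightarrow> ('g \<times> (bool \<times> 'g) list) set" where
  "split_forms \<sigma> = {(v, l). v \<in> V \<sigma> \<and> l \<in> normal_tails \<and> (l = [] \<or> fst (hd l) \<noteq> \<sigma>)}"

definition fuse :: "bool \<Rightarrow> 'g \<times> (bool \<times> 'g) list \<Rightarrow> 'g \<times> (bool \<times> 'g) list" where
  "fuse \<sigma> \<omega> = (case snd \<omega> of [] \<Rightarrow> \<omega>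
     | (\<tau>, t) # l \<Rightarrow> if \<tau> = \<sigma> then (fst \<omega> \<otimes> t, l) else \<omega>)"

definition normalize :: "bool \<Rightarrow> 'g \<times> (bool \<times> 'g) list \<Rightarrow> 'g \<times> (bool \<times> 'g) list" where
  "normalize \<sigma> \<psi> = (fst \<psi> \<otimes> inv (coset_rep (fst \<psi>)),
     if fst \<psi> \<in> C then snd \<psi> else (\<sigma>, coset_rep (fst \<psi>)) # snd \<psi>)"

text \<open>Left multiplication on \<open>split_forms \<sigma>\<close>, transported to the set of
  normal forms that both factors share.\<close>

definition act :: "bool \<Rightarrow> 'g \<Rightarrow> 'g \<times> (bool \<times> 'g) list \<Rightarrow> 'g \<times> (bool \<times> 'g) list" where
  "act \<sigma> v = (\<lambda>\<omega>\<in>normal_forms. normalize \<sigma> (v \<otimes> fst (fuse \<sigma> \<omega>), snd (fuse \<sigma> \<omega>)))"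

lemma C_subgroup: "subgroup C G"
  unfolding C_def by (intro subgroups_Inter_pair factors)

lemma C_factor: "c \<in> C \<Longrightarrow> c \<in> V \<sigma>"
  by (cases \<sigma>) (auto simp: C_def)

lemma C_Int: "\<sigma> \<noteq> \<tau> \<Longrightarrow> v \<in> V \<sigma> \<Longrightarrow> v \<in> V \<tau> \<Longrightarrow> v \<in> C"
  by (cases \<sigma>; cases \<tau>) (auto simp: C_def)

lemma factor_closed: "v \<in> V \<sigma> \<Longrightarrow> v \<in> carrier G"
  by (rule subgroup.mem_carrier[OF factors])

lemma C_closed: "c \<in> C \<Longrightarrow> c \<in> carrier G"
  by (rule subgroup.mem_carrier[OF C_subgroup])

lemmas factor_rules = subgroup.m_closed[OF factors] subgroup.m_inv_closed[OF factors]
  subgroup.one_closed[OF factors]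
lemmas C_rules = subgroup.m_closed[OF C_subgroup] subgroup.m_inv_closed[OF C_subgroup]
  subgroup.one_closed[OF C_subgroup]

lemma mult_C_iff:
  assumes "c \<in> C" "v \<in> carrier G"
  shows "c \<otimes> v \<in> C \<longleftrightarrow> v \<in> C" and "v \<otimes> c \<in> C \<longleftrightarrow> v \<in> C"
proof -
  have "v = inv c \<otimes> (c \<otimes> v)" "v = (v \<otimes> c) \<otimes> inv c"
    using assms C_closed by (simp_all add: m_assoc[symmetric]) (simp add: m_assoc)
  then show "c \<otimes> v \<in> C \<longleftrightarrow> v \<in> C" "v \<otimes> c \<in> C \<longleftrightarrow> v \<in> C"
    using assms C_rules by metis+
qed

lemma coset_rep_decomp:
  assumes "v \<in> carrier G"
  shows "\<exists>c\<in>C. coset_rep v = c \<otimes> v"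
proof (cases "v \<in> C")
  case True
  then have "\<one> = inv v \<otimes> v" "inv v \<in> C" using assms C_rules by auto
  then show ?thesis using True by (auto simp: coset_rep_def)
next
  case False
  have "v \<in> C #> v" using assms C_subgroup by (simp add: rcos_self)
  then have "(SOME t. t \<in> C #> v) \<in> C #> v" by (rule someI)
  then show ?thesis using False by (auto simp: coset_rep_def r_coset_def)
qed

lemma coset_rep_closed: "v \<in> carrier G \<Longrightarrow> coset_rep v \<in> carrier G"
  using coset_rep_decomp C_closed by force

lemma coset_rep_factor: "v \<in> V \<sigma> \<Longrightarrow> coset_rep v \<in> V \<sigma>"
  using coset_rep_decomp[of v] factor_closed C_factor factor_rules by metis

lemma coset_rep_not_C: "v \<in> carrier G \<Longrightarrow> v \<notin> C \<Longrightarrow> coset_rep v \<notin> C"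
  using coset_rep_decomp mult_C_iff by metis

lemma mult_inv_coset_rep:
  assumes "v \<in> carrier G" shows "v \<otimes> inv (coset_rep v) \<in> C"
proof -
  obtain c where c: "c \<in> C" "coset_rep v = c \<otimes> v" using coset_rep_decomp[OF assms] ..
  then have "v \<otimes> inv (coset_rep v) = inv c"
    using assms C_closed by (simp add: inv_mult_group m_assoc[symmetric])
  then show ?thesis using c C_rules by simp
qed

lemma coset_rep_mult:
  assumes "c \<in> C" "v \<in> carrier G" shows "coset_rep (c \<otimes> v) = coset_rep v"
proof -
  have "C #> (c \<otimes> v) = C #> v"
    using assms C_subgroup C_closed
    by (metis coset_mult_assoc coset_join2 subgroup.subset)
  then show ?thesis using assms by (simp add: coset_rep_def mult_C_iff)
qed

lemma coset_rep_idem: "v \<in> carrier G \<Longrightarrow> coset_rep (coset_rep v) = coset_rep v"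
  using coset_rep_decomp coset_rep_mult by metis

lemma coset_rep_C: "c \<in> C \<Longrightarrow> coset_rep c = \<one>"
  by (simp add: coset_rep_def)

lemma normal_tails_Cons:
  "(\<sigma>, t) # l \<in> normal_tails \<longleftrightarrow> l \<in> normal_tails \<and> (l = [] \<or> fst (hd l) \<noteq> \<sigma>) \<and>
     t \<in> V \<sigma> - C \<and> coset_rep t = t"
  by (cases l) (auto simp: normal_tails_def)

lemma fuse_split_forms: "\<omega> \<in> normal_forms \<Longrightarrow> fuse \<sigma> \<omega> \<in> split_forms \<sigma>"
  by (cases \<omega>; cases "snd \<omega>")
    (auto simp: fuse_def normal_forms_def split_forms_def C_factor normal_tails_Cons factor_rules)

lemma normalize_normal_forms: "\<psi> \<in> split_forms \<sigma> \<Longrightarrow> normalize \<sigma> \<psi> \<in> normal_forms"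
  by (cases \<psi>)
    (auto simp: normalize_def normal_forms_def split_forms_def normal_tails_Cons
      mult_inv_coset_rep factor_closed coset_rep_factor coset_rep_not_C coset_rep_idem)

lemma normalize_fuse:
  assumes "\<omega> \<in> normal_forms" shows "normalize \<sigma> (fuse \<sigma> \<omega>) = \<omega>"
proof -
  obtain c l where \<omega>: "\<omega> = (c, l)" by fastforce
  have c: "c \<in> C" "c \<in> carrier G" using assms \<omega> C_closed by (auto simp: normal_forms_def)
  show ?thesis
  proof (cases "\<exists>t l'. l = (\<sigma>, t) # l'")
    case True
    then obtain t l' where l: "l = (\<sigma>, t) # l'" by blast
    then have t: "t \<in> V \<sigma> - C" "coset_rep t = t"
      using assms \<omega> by (auto simp: normal_forms_def normal_tails_Cons)
    then have "t \<in> carrier G" using factor_closed by blast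
    then show ?thesis
      using c t by (simp add: \<omega> l fuse_def normalize_def coset_rep_mult mult_C_iff m_assoc)
  next
    case False
    then have "fuse \<sigma> \<omega> = \<omega>"
      by (auto simp: fuse_def \<omega> split: list.split)
    then show ?thesis using c by (simp add: \<omega> normalize_def coset_rep_C)
  qed
qed

lemma fuse_normalize:
  assumes "\<psi> \<in> split_forms \<sigma>" shows "fuse \<sigma> (normalize \<sigma> \<psi>) = \<psi>"
proof -
  obtain v l where \<psi>: "\<psi> = (v, l)" by fastforce
  have v: "v \<in> V \<sigma>" "v \<in> carrier G" and l: "l = [] \<or> fst (hd l) \<noteq> \<sigma>"
    using assms \<psi> factor_closed by (auto simp: split_forms_def)
  then show ?thesis
    by (cases "v \<in> C")
      (auto simp: \<psi> fuse_def normalize_def coset_rep_C m_assoc coset_rep_closed split: list.split)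
qed

section \<open>The actions of the two factors on normal forms\<close>

lemma act_closed:
  assumes "v \<in> V \<sigma>" "\<omega> \<in> normal_forms" shows "act \<sigma> v \<omega> \<in> normal_forms"
proof -
  have "(v \<otimes> fst (fuse \<sigma> \<omega>), snd (fuse \<sigma> \<omega>)) \<in> split_forms \<sigma>"
    using fuse_split_forms[OF assms(2), of \<sigma>] assms(1) by (auto simp: split_forms_def factor_rules)
  then show ?thesis using assms normalize_normal_forms by (simp add: act_def)
qed

lemma act_mult:
  assumes "v \<in> V \<sigma>" "w \<in> V \<sigma>" "\<omega> \<in> normal_forms"
  shows "act \<sigma> (v \<otimes> w) \<omega> = act \<sigma> v (act \<sigma> w \<omega>)"
proof -
  have f: "fuse \<sigma> \<omega> \<in> split_forms \<sigma>" using assms fuse_split_forms by blast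
  then have "fst (fuse \<sigma> \<omega>) \<in> V \<sigma>" by (auto simp: split_forms_def)
  moreover from this f have "(w \<otimes> fst (fuse \<sigma> \<omega>), snd (fuse \<sigma> \<omega>)) \<in> split_forms \<sigma>"
    using assms by (auto simp: split_forms_def factor_rules)
  ultimately show ?thesis
    using assms act_closed[OF assms(2,3)]
    by (simp add: act_def fuse_normalize m_assoc factor_closed)
qed

lemma act_one:
  assumes "\<omega> \<in> normal_forms" shows "act \<sigma> \<one> \<omega> = \<omega>"
proof -
  have "fst (fuse \<sigma> \<omega>) \<in> carrier G"
    using fuse_split_forms[OF assms, of \<sigma>] factor_closed by (auto simp: split_forms_def)
  then show ?thesis using assms normalize_fuse by (simp add: act_def)
qed

lemma act_Bij:
  assumes "v \<in> V \<sigma>" shows "act \<sigma> v \<in> Bij normal_forms"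
proof -
  have "bij_betw (act \<sigma> v) normal_forms normal_forms"
    using assms act_mult[of v \<sigma> "inv v"] act_mult[of "inv v" \<sigma> v]
    by (intro bij_betw_byWitness[of _ "act \<sigma> (inv v)"])
      (auto simp: act_closed factor_rules act_one factor_closed)
  then show ?thesis by (simp add: Bij_def act_def)
qed

lemma act_hom: "act \<sigma> \<in> hom (G\<lparr>carrier := V \<sigma>\<rparr>) (BijGroup normal_forms)"
proof (rule homI)
  fix v w assume "v \<in> carrier (G\<lparr>carrier := V \<sigma>\<rparr>)" "w \<in> carrier (G\<lparr>carrier := V \<sigma>\<rparr>)"
  then have vw: "v \<in> V \<sigma>" "w \<in> V \<sigma>" by simp_all
  have "act \<sigma> (v \<otimes> w) = compose normal_forms (act \<sigma> v) (act \<sigma> w)"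
  proof (rule extensionalityI[of _ normal_forms])
    show "act \<sigma> (v \<otimes> w) \<in> extensional normal_forms" by (simp add: act_def)
  qed (auto simp: compose_eq act_mult vw)
  then show "act \<sigma> (v \<otimes>\<^bsub>G\<lparr>carrier := V \<sigma>\<rparr>\<^esub> w) = act \<sigma> v \<otimes>\<^bsub>BijGroup normal_forms\<^esub> act \<sigma> w"
    using vw act_Bij by (simp add: BijGroup_def)
qed (use act_Bij in \<open>simp add: BijGroup_def\<close>)

text \<open>The result does not involve \<sigma>, so the two actions agree on the amalgamated
  subgroup, as \<open>extend\<close> requires.\<close>

lemma act_C:
  assumes "c \<in> C" "(c', l) \<in> normal_forms" shows "act \<sigma> c (c', l) = (c \<otimes> c', l)"
proof -
  have c: "c' \<in> C" "c' \<in> carrier G" "c \<in> carrier G" "l \<in> normal_tails"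
    using assms C_closed by (auto simp: normal_forms_def)
  then have "(c \<otimes> c', l) \<in> normal_forms" using assms by (simp add: normal_forms_def C_rules)
  moreover have "fuse \<sigma> (c \<otimes> c', l) = (c \<otimes> fst (fuse \<sigma> (c', l)), snd (fuse \<sigma> (c', l)))"
    using c by (auto simp: fuse_def normal_tails_Cons factor_closed m_assoc split: list.split)
  ultimately show ?thesis
    using normalize_fuse[of "(c \<otimes> c', l)" \<sigma>] assms by (simp add: act_def)
qed

text \<open>The leading letter is not from \<open>V \<sigma>\<close>, so nothing can be absorbed and
  the tail grows by one letter. Counting letters rests on this.\<close>

lemma act_not_C:
  assumes "v \<in> V \<sigma> - C" "(c, l) \<in> normal_forms" "l = [] \<or> fst (hd l) \<noteq> \<sigma>"
  shows "\<exists>c' t. act \<sigma> v (c, l) = (c', (\<sigma>, t) # l)"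
proof -
  have "c \<in> C" using assms by (simp add: normal_forms_def)
  then have "v \<otimes> c \<notin> C" using assms factor_closed[of v \<sigma>] by (simp add: mult_C_iff)
  moreover have "fuse \<sigma> (c, l) = (c, l)"
    using assms by (auto simp: fuse_def split: list.split)
  ultimately show ?thesis using assms by (simp add: act_def normalize_def)
qed

section \<open>Reduced products\<close>

definition reduced :: "(bool \<times> 'g) list \<Rightarrow> bool" where
  "reduced us \<longleftrightarrow> distinct_adj (map fst us) \<and> (\<forall>(\<sigma>, u)\<in>set us. u \<in> V \<sigma> - C)"

definition product :: "(bool \<times> 'g) list \<Rightarrow> 'g" where
  "product us = foldr (\<lambda>u g. snd u \<otimes> g) us \<one>"

lemma reduced_Cons:
  "reduced ((\<sigma>, u) # us) \<longleftrightarrow> reduced us \<and> (us = [] \<or> fst (hd us) \<noteq> \<sigma>) \<and> u \<in> V \<sigma> - C"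
  by (cases us) (auto simp: reduced_def)

lemma product_Nil: "product [] = \<one>" and product_Cons: "product (u # us) = snd u \<otimes> product us"
  by (simp_all add: product_def)

lemma product_closed: "snd ` set us \<subseteq> carrier G \<Longrightarrow> product us \<in> carrier G"
  by (induction us) (auto simp: product_Nil product_Cons)

lemma product_append:
  "snd ` set us \<subseteq> carrier G \<Longrightarrow> snd ` set vs \<subseteq> carrier G \<Longrightarrow>
    product (us @ vs) = product us \<otimes> product vs"
  by (induction us) (auto simp: product_Nil product_Cons product_closed m_assoc)

lemma product_inv:
  "snd ` set us \<subseteq> carrier G \<Longrightarrow> product (rev (map (apsnd (\<lambda>u. inv u)) us)) = inv (product us)"
proof (induction us)
  case (Cons u us)
  have "snd ` set (rev (map (apsnd (\<lambda>u. inv u)) us)) \<subseteq> carrier G"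
    using Cons.prems by auto
  then show ?case
    using Cons by (simp add: product_append product_Cons product_Nil product_closed inv_mult_group)
qed (simp add: product_Nil)

lemma reduced_closed: "reduced us \<Longrightarrow> snd ` set us \<subseteq> carrier G"
  using factor_closed by (fastforce simp: reduced_def)

lemma reduced_inv: "reduced us \<Longrightarrow> reduced (rev (map (apsnd (\<lambda>u. inv u)) us))"
proof -
  have "inv u \<in> V \<sigma> - C" if "u \<in> V \<sigma> - C" for u \<sigma>
    using that factor_rules C_rules factor_closed by (metis DiffD1 DiffD2 DiffI inv_inv)
  moreover assume "reduced us"
  moreover have "map fst (map (apsnd (\<lambda>u. inv u)) us) = map fst us" by simp
  ultimately show ?thesis
    unfolding reduced_def rev_map[symmetric] distinct_adj_rev by fastforce
qed

text \<open>The normal form theorem. Applied to the trivial form, a reduced product creates one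
  letter per factor, whereas an element of \<open>V \<tau>\<close> creates at most one. The
  conjugate has a reduced expression of at least three letters.\<close>

lemma reduced_conj_not_factor:
  assumes us: "reduced us" "us \<noteq> []" "fst (hd us) \<noteq> \<sigma>" and h: "h \<in> V \<sigma> - C"
  shows "inv (product us) \<otimes> h \<otimes> product us \<notin> V \<tau>"
proof
  assume mem: "inv (product us) \<otimes> h \<otimes> product us \<in> V \<tau>"
  \<comment> \<open>The conjugate spelled out letter by letter; the neighbours of \<open>h\<close>
    on both sides come from the factor of \<open>hd us\<close>, which is not \<sigma>, so the word
    is reduced.\<close>
  let ?w = "rev (map (apsnd (\<lambda>u. inv u)) us) @ (\<sigma>, h) # us"
  have last: "last (map fst (rev (map (apsnd (\<lambda>u. inv u)) us))) = fst (hd us)"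
    using us(2) by (cases us) auto
  have red: "reduced ?w"
    using us h last reduced_inv[OF us(1)] reduced_Cons[of \<sigma> h us]
    unfolding reduced_def by (auto simp: distinct_adj_append_iff)
  have h': "h \<in> carrier G" using h factor_closed by blast
  have prod: "product ?w = inv (product us) \<otimes> h \<otimes> product us"
    using reduced_closed[OF us(1)] reduced_closed[OF reduced_inv[OF us(1)]] h'
    by (simp add: product_append product_Cons product_inv product_closed m_assoc)
  \<comment> \<open>The two factor actions glue to an action of the whole group.\<close>
  have "\<exists>\<phi>\<in>hom G (BijGroup normal_forms). \<forall>\<sigma>. \<forall>v\<in>V \<sigma>. \<phi> v = act \<sigma> v"
  proof (rule extend[OF act_hom])
    fix v assume "v \<in> V True" "v \<in> V False"
    then have v: "v \<in> C" by (simp add: C_def)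
    show "act True v = act False v"
    proof (rule extensionalityI[of _ normal_forms])
      show "act True v \<omega> = act False v \<omega>" if "\<omega> \<in> normal_forms" for \<omega>
        using that v by (cases \<omega>) (simp add: act_C)
    qed (simp_all add: act_def)
  qed
  then obtain \<phi> where \<phi>: "\<phi> \<in> hom G (BijGroup normal_forms)"
    and \<phi>_act: "\<And>\<sigma> v. v \<in> V \<sigma> \<Longrightarrow> \<phi> v = act \<sigma> v" by blast
  interpret \<phi>: group_hom G "BijGroup normal_forms" \<phi>
    by (intro group_hom.intro group_hom_axioms.intro is_group group_BijGroup \<phi>)
  have base: "(\<one>, []) \<in> normal_forms" by (simp add: normal_forms_def normal_tails_def C_rules)
  \<comment> \<open>Stronger than a count: the sequence of factors is preserved, so that the
    induction knows the next letter to differ in type from the head of the tail.\<close>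
  have length: "\<phi> (product vs) (\<one>, []) \<in> normal_forms \<and>
      map fst (snd (\<phi> (product vs) (\<one>, []))) = map fst vs" if "reduced vs" for vs
    using that
  proof (induction vs)
    case Nil
    have "\<phi> \<one> (\<one>, []) = (\<one>, [])"
      using \<phi>_act[of \<one> True] base by (simp add: factor_rules act_one del: \<phi>.hom_one)
    then show ?case using base by (simp add: product_Nil del: \<phi>.hom_one)
  next
    case (Cons u vs)
    obtain \<tau> v where u: "u = (\<tau>, v)" by fastforce
    have vs: "reduced vs" "vs = [] \<or> fst (hd vs) \<noteq> \<tau>" "v \<in> V \<tau> - C"
      using Cons.prems by (simp_all add: u reduced_Cons)
    obtain c l where l: "\<phi> (product vs) (\<one>, []) = (c, l)" by fastforce
    with Cons.IH[OF vs(1)] have cl: "(c, l) \<in> normal_forms" "map fst l = map fst vs" by simp_all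
    have hd: "l = [] \<or> fst (hd l) \<noteq> \<tau>"
      using vs(2) cl(2) by (cases l; cases vs) auto
    have v: "v \<in> carrier G" "product vs \<in> carrier G"
      using vs factor_closed reduced_closed product_closed by auto
    then have "\<phi> (v \<otimes> product vs) (\<one>, []) = \<phi> v (\<phi> (product vs) (\<one>, []))"
      using \<phi>.hom_mult[OF v] \<phi>.hom_closed[OF v(1)] \<phi>.hom_closed[OF v(2)] base
      by (simp add: BijGroup_def compose_eq del: \<phi>.hom_mult \<phi>.hom_closed)
    also have "\<dots> = act \<tau> v (c, l)" using \<phi>_act vs l by auto
    finally show ?case
      using act_not_C[OF vs(3) cl(1) hd] act_closed[of v \<tau>, OF _ cl(1)] vs(3) cl(2)
      by (auto simp: u product_Cons)
  qed
  have "length (snd (act \<tau> v (\<one>, []))) \<le> 1" if "v \<in> V \<tau>" for v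
    using that base by (simp add: act_def fuse_def normalize_def)
  then have "length (snd (\<phi> (product ?w) (\<one>, []))) \<le> 1"
    using \<phi>_act[OF mem] mem prod by simp
  moreover have "length (snd (\<phi> (product ?w) (\<one>, []))) = length ?w"
    using length[OF red] by (metis length_map)
  ultimately show False using us(2) by simp
qed

text \<open>Such products are stable under left multiplication by a factor: the new element merges
  with \<open>c\<close>, and also with the first letter if that comes from the same factor.\<close>

lemma reduced_decomposition:
  assumes "g \<in> carrier G"
  shows "\<exists>c\<in>C. \<exists>us. reduced us \<and> g = c \<otimes> product us"
proof -
  define N where "N = {c \<otimes> product us | c us. c \<in> C \<and> reduced us}"
  have N: "c \<otimes> product us \<in> N" if "c \<in> C" "reduced us" for c us
    using that by (auto simp: N_def)
  have closed: "N \<subseteq> carrier G"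
    using C_closed reduced_closed product_closed by (auto simp: N_def)
  have nil: "reduced []" by (simp add: reduced_def)
  \<comment> \<open>An element of \<open>C\<close> becomes the front component; any other becomes a
    new first letter behind \<open>\<one>\<close>.\<close>
  have fold: "v \<otimes> product us \<in> N" if v: "v \<in> V \<sigma>" and us: "reduced us" "us = [] \<or> fst (hd us) \<noteq> \<sigma>" for v \<sigma> us
  proof (cases "v \<in> C")
    case False
    then have red: "reduced ((\<sigma>, v) # us)" using v us by (simp add: reduced_Cons)
    from N[OF C_rules(3) this] show ?thesis
      using reduced_closed[OF red] by (simp add: product_Cons product_closed)
  qed (use N us in blast)
  have step: "v \<otimes> n \<in> N" if v: "v \<in> V \<sigma>" and n: "n \<in> N" for v \<sigma> n
  proof -
    obtain c us where cu: "c \<in> C" "reduced us" "n = c \<otimes> product us"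
      using n by (auto simp: N_def)
    have car: "v \<in> carrier G" "c \<in> carrier G" "snd ` set us \<subseteq> carrier G"
      using v cu factor_closed C_closed reduced_closed by auto
    have vc: "v \<otimes> c \<in> V \<sigma>" using v cu C_factor factor_rules by blast
    show ?thesis
    proof (cases "us = [] \<or> fst (hd us) \<noteq> \<sigma>")
      case True
      then show ?thesis
        using fold[OF vc cu(2)] car cu(3) by (simp add: m_assoc product_closed)
    next
      case False
      then obtain u vs where us: "us = (\<sigma>, u) # vs" by (cases us) auto
      with cu have "reduced vs" "vs = [] \<or> fst (hd vs) \<noteq> \<sigma>" "u \<in> V \<sigma>" by (simp_all add: reduced_Cons)
      then have "v \<otimes> c \<otimes> u \<otimes> product vs \<in> N" using vc by (intro fold) (auto intro: factor_rules)
      then show ?thesis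
        using car cu(3) by (simp add: us product_Cons m_assoc product_closed)
    qed
  qed
  have "g \<otimes> \<one> \<in> N"
  proof (rule generate_left_closed[OF _ closed])
    show "V True \<union> V False \<subseteq> carrier G" using factor_closed by blast
    show "g \<in> generate G (V True \<union> V False)" using assms generated by simp
    show "\<one> \<in> N" using N[OF C_rules(3) nil] by (simp add: product_Nil)
    show "v \<otimes> n \<in> N \<and> inv v \<otimes> n \<in> N" if "v \<in> V True \<union> V False" "n \<in> N" for v n
      using that step factor_rules(2) by blast
  qed
  then show ?thesis using assms by (auto simp: N_def)
qed

text \<open>In terms of the Bass--Serre tree: \<open>P\<close> and \<open>g Q g\<^sup>-\<^sup>1\<close> fix a vertex each, so their intersection
  fixes the path between these vertices, and may be computed by successive intersections with edge
  stabilizers, each inside a vertex stabilizer.\<close>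

lemma conj_Int_closed:
  assumes sub: "\<And>P. P \<in> \<P> \<Longrightarrow> P \<subseteq> carrier G"
    and conj: "\<And>P g. P \<in> \<P> \<Longrightarrow> g \<in> carrier G \<Longrightarrow> conj_subgroup G g P \<in> \<P>"
    and Int: "\<And>P Q \<sigma>. P \<in> \<P> \<Longrightarrow> Q \<in> \<P> \<Longrightarrow> P \<subseteq> V \<sigma> \<Longrightarrow> Q \<subseteq> V \<sigma> \<Longrightarrow> P \<inter> Q \<in> \<P>"
    and C: "C \<in> \<P>"
    and P: "P \<in> \<P>" "P \<subseteq> V \<sigma>" and Q: "Q \<in> \<P>" "Q \<subseteq> V \<tau>" and g: "g \<in> carrier G"
  shows "P \<inter> conj_subgroup G g Q \<in> \<P>"
proof -
  have Q_closed: "Q \<subseteq> carrier G" using Q sub by blast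
  \<comment> \<open>Conjugating by \<open>inv u\<close> strips \<open>u\<close> off the conjugator,
    which drives the induction on the number of letters.\<close>
  have pull: "P \<inter> conj_subgroup G (u \<otimes> w) Q
      = conj_subgroup G u (conj_subgroup G (inv u) P \<inter> conj_subgroup G w Q)"
    if "P \<in> \<P>" "u \<in> carrier G" "w \<in> carrier G" for P u w
    using that sub[OF that(1)] Q_closed
    by (simp add: conj_subgroup_one conj_subgroup_Int conj_subgroup_closed conj_subgroup_inv conj_subgroup_mult)
  have *: "P \<inter> conj_subgroup G (product us) Q \<in> \<P>"
    if "reduced us" "P \<in> \<P>" "P \<subseteq> V \<sigma>" for us P \<sigma>
    using that
  proof (induction us arbitrary: P \<sigma>)
    case Nil
    have PC: "P \<inter> C \<in> \<P>" using Int[OF Nil(2) C Nil(3)] C_factor by blast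
    have "P \<inter> Q \<in> \<P>"
    proof (cases "\<sigma> = \<tau>")
      case True
      then show ?thesis using Int Nil Q by blast
    next
      case False
      \<comment> \<open>Subgroups in different factors meet inside \<open>C\<close>, so two
        intersections suffice, each within a single factor.\<close>
      then have "P \<inter> Q = (P \<inter> C) \<inter> Q" using Nil(3) Q(2) C_Int by blast
      then show ?thesis using Int[OF PC Q(1) _ Q(2)] C_factor by auto
    qed
    then show ?case using Q_closed by (simp add: product_Nil conj_subgroup_one)
  next
    case (Cons u us)
    obtain \<sigma>' v where u: "u = (\<sigma>', v)" by fastforce
    have us: "reduced us" "v \<in> V \<sigma>'" using Cons.prems by (auto simp: u reduced_Cons)
    have car: "v \<in> carrier G" "product us \<in> carrier G" "product (u # us) \<in> carrier G"
      using us factor_closed reduced_closed[OF us(1)] reduced_closed[OF Cons.prems(1)] product_closed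
      by auto
    have PC: "P \<inter> C \<in> \<P>" using Int[OF Cons.prems(2) C Cons.prems(3)] C_factor by blast
    \<comment> \<open>Before stripping \<open>v\<close>, the left subgroup must lie in the factor of
      \<open>v\<close>. If it does not, it can be cut down to \<open>P \<inter> C\<close> without
      changing the intersection.\<close>
    have "\<exists>P'\<in>\<P>. P' \<subseteq> V \<sigma>' \<and>
      P \<inter> conj_subgroup G (product (u # us)) Q = P' \<inter> conj_subgroup G (product (u # us)) Q"
    proof (cases "\<sigma> = \<sigma>'")
      case True
      then show ?thesis using Cons.prems by blast
    next
      case False
      \<comment> \<open>Outside \<open>C\<close>, the conjugate of \<open>h\<close> would leave
        \<open>V \<tau>\<close>, yet it is an element of \<open>Q\<close>.\<close>
      have "h \<in> C" if h: "h \<in> P" "h \<in> conj_subgroup G (product (u # us)) Q" for h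
      proof (rule ccontr)
        assume "h \<notin> C"
        then have "inv (product (u # us)) \<otimes> h \<otimes> product (u # us) \<notin> V \<tau>"
          using Cons.prems h False by (intro reduced_conj_not_factor[where \<sigma> = \<sigma>]) (auto simp: u)
        moreover obtain q where q: "q \<in> Q" "h = product (u # us) \<otimes> q \<otimes> inv (product (u # us))"
          using h(2) by (auto simp: conj_subgroup_image)
        moreover have "inv (product (u # us)) \<otimes> h \<otimes> product (u # us) = q"
          using q Q_closed car(3) by (auto simp: m_assoc inv_solve_left' subset_iff)
        ultimately show False using Q(2) by auto
      qed
      then show ?thesis using PC C_factor by (intro bexI[of _ "P \<inter> C"]) auto
    qed
    then obtain P' where P': "P' \<in> \<P>" "P' \<subseteq> V \<sigma>'"
      "P \<inter> conj_subgroup G (product (u # us)) Q = P' \<inter> conj_subgroup G (product (u # us)) Q"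
      by blast
    have "conj_subgroup G (inv v) P' \<inter> conj_subgroup G (product us) Q \<in> \<P>"
    proof (rule Cons.IH[OF us(1)])
      show "conj_subgroup G (inv v) P' \<in> \<P>" using conj P' car by simp
      show "conj_subgroup G (inv v) P' \<subseteq> V \<sigma>'"
        using P' us factors factor_rules by (intro conj_subgroup_subset) auto
    qed
    then show ?case
      unfolding P'(3) unfolding product_Cons u snd_conv pull[OF P'(1) car(1,2)] using car by (intro conj)
  qed
  obtain c us where cu: "c \<in> C" "reduced us" "g = c \<otimes> product us"
    using reduced_decomposition[OF g] by blast
  have car: "c \<in> carrier G" "product us \<in> carrier G"
    using cu C_closed reduced_closed product_closed by auto
  have "conj_subgroup G (inv c) P \<inter> conj_subgroup G (product us) Q \<in> \<P>"
  proof (rule *[OF cu(2)])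
    show "conj_subgroup G (inv c) P \<in> \<P>" using conj P car by simp
    show "conj_subgroup G (inv c) P \<subseteq> V \<sigma>"
      using P cu factors factor_rules C_factor by (intro conj_subgroup_subset) auto
  qed
  then show ?thesis
    unfolding cu(3) pull[OF P(1) car] using car by (intro conj)
qed

end

section \<open>Parabolic subgroups\<close>

context retractable begin

lemma parabolic_closed: "parabolic S m P \<Longrightarrow> P \<subseteq> carrier G"
  unfolding parabolic_def
  by (elim bexE exE conjE) (simp add: conj_subgroup_closed std_parabolic_closed)

lemma parabolic_std: "X \<subseteq> S \<Longrightarrow> parabolic S m (std_parabolic S m X)"
  unfolding parabolic_def
  by (intro bexI[of _ "\<one>\<^bsub>G\<^esub>"] exI[of _ X]) (simp_all add: conj_subgroup_one std_parabolic_closed)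

lemma parabolic_conj:
  assumes "parabolic S m P" "g \<in> carrier G" shows "parabolic S m (conj_subgroup G g P)"
proof -
  obtain h X where "h \<in> carrier G" "X \<subseteq> S" "P = conj_subgroup G h (std_parabolic S m X)"
    using assms(1) by (auto simp: parabolic_def)
  then show ?thesis
    using assms(2) std_parabolic_closed[of X S m] m_closed[of g h]
    by (auto simp: parabolic_def conj_subgroup_mult)
qed

lemma core_subset: "core m X Y \<subseteq> X"
  by (auto simp: core_def odd_part_def)

text \<open>The retraction to \<open>X\<close> fixes \<open>P\<close> pointwise, so \<open>P\<close>
  is its own image, and the image of a conjugate is a conjugate by an element of the subgroup on
  \<open>X\<close>.\<close>

lemma parabolic_in_std:
  assumes X: "X \<subseteq> S" and P: "parabolic S m P" "P \<subseteq> std_parabolic S m X"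
  shows "\<exists>a\<in>std_parabolic S m X. \<exists>K\<subseteq>X. P = conj_subgroup G a (std_parabolic S m K)"
proof -
  obtain g Y where gY: "g \<in> carrier G" "Y \<subseteq> S" "P = conj_subgroup G g (std_parabolic S m Y)"
    using P(1) by (auto simp: parabolic_def)
  obtain \<rho> where \<rho>: "ordinary_retraction S m X \<rho>" using obtain_retraction[OF X] .
  interpret \<rho>: group_hom G G \<rho> using \<rho> X by (rule ordinary_retraction_hom)
  have "P = \<rho> ` P"
    using P(2) ordinary_retraction_id[OF \<rho> X] by force
  also have "\<dots> = conj_subgroup G (\<rho> g) (std_parabolic S m (core m X Y))"
    using gY std_parabolic_closed[of Y S m]
    by (simp add: \<rho>.conj_subgroup_hom ordinary_retraction_std_parabolic[OF labels \<rho> X])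
  finally show ?thesis
    using ordinary_retraction_mem[OF \<rho> gY(1)] core_subset by blast
qed

text \<open>Turns containment into a bound on the number of generators, which the induction on
  \<open>card X\<close> needs.\<close>

lemma parabolic_in_conj:
  assumes H: "H \<subseteq> S" and d: "d \<in> carrier G" and P: "parabolic S m P"
    and sub: "P \<subseteq> conj_subgroup G d (std_parabolic S m H)"
  shows "\<exists>a\<in>carrier G. \<exists>K\<subseteq>H. P = conj_subgroup G a (std_parabolic S m K)"
proof -
  have "conj_subgroup G (inv\<^bsub>G\<^esub> d) P \<subseteq> std_parabolic S m H"
    using conj_subgroup_mono[OF sub, of "inv\<^bsub>G\<^esub> d"] d H by (simp add: conj_subgroup_inv std_parabolic_closed)
  moreover have "parabolic S m (conj_subgroup G (inv\<^bsub>G\<^esub> d) P)"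
    using P d by (simp add: parabolic_conj)
  ultimately obtain a K where aK: "a \<in> std_parabolic S m H" "K \<subseteq> H"
    "conj_subgroup G (inv\<^bsub>G\<^esub> d) P = conj_subgroup G a (std_parabolic S m K)"
    using parabolic_in_std[OF H] by blast
  have car: "a \<in> carrier G" "std_parabolic S m K \<subseteq> carrier G" "P \<subseteq> carrier G"
    using aK H std_parabolic_closed[OF H, of m] std_parabolic_closed[of K S m] parabolic_closed[OF P]
    by auto
  have "P = conj_subgroup G d (conj_subgroup G (inv\<^bsub>G\<^esub> d) P)"
    using car d by (simp add: conj_subgroup_inv)
  also have "\<dots> = conj_subgroup G (d \<otimes>\<^bsub>G\<^esub> a) (std_parabolic S m K)"
    using aK(3) car d by (simp add: conj_subgroup_mult)
  finally show ?thesis using aK(2) car d by blast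
qed

text \<open>By \<open>parabolic_in_std\<close> the conjugating elements can be taken in the subgroup
  on \<open>T\<close>. Hence both groups come from parabolic subgroups of the abstract group on
  \<open>T\<close>, where \<open>IH\<close> applies, and the embedding carries the result
  back.\<close>

lemma parabolic_Int_transfer:
  assumes T: "T \<subseteq> S"
    and IH: "\<And>P Q. parabolic T m P \<Longrightarrow> parabolic T m Q \<Longrightarrow> parabolic T m (P \<inter> Q)"
    and P: "parabolic S m P" "P \<subseteq> std_parabolic S m T"
    and Q: "parabolic S m Q" "Q \<subseteq> std_parabolic S m T"
  shows "parabolic S m (P \<inter> Q)"
proof -
  let ?H = "artin_group T m"
  interpret T: retractable T m
    using retractable_subset[OF retractable_axioms T] .
  obtain \<iota> where \<iota>: "group_hom ?H G \<iota>" and inj: "inj_on \<iota> (carrier ?H)"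
    and img: "\<And>X. X \<subseteq> T \<Longrightarrow> \<iota> ` std_parabolic T m X = std_parabolic S m X"
    using subsystem_embedding[OF T] by blast
  interpret \<iota>: group_hom ?H G \<iota> by (rule \<iota>)
  have push: "\<iota> ` conj_subgroup ?H b (std_parabolic T m X) = conj_subgroup G (\<iota> b) (std_parabolic S m X)"
    if "b \<in> carrier ?H" "X \<subseteq> T" for b X
    using that img by (simp add: \<iota>.conj_subgroup_hom std_parabolic_closed)
  have pull: "\<exists>P'. parabolic T m P' \<and> P = \<iota> ` P'"
    if P: "parabolic S m P" "P \<subseteq> std_parabolic S m T" for P
  proof -
    obtain a K where aK: "a \<in> std_parabolic S m T" "K \<subseteq> T" "P = conj_subgroup G a (std_parabolic S m K)"
      using parabolic_in_std[OF T P] by blast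
    have "\<iota> ` carrier ?H = std_parabolic S m T"
      using img[of T] by (simp add: std_parabolic_carrier)
    with aK(1) obtain b where b: "b \<in> carrier ?H" "a = \<iota> b" by blast
    then have "P = \<iota> ` conj_subgroup ?H b (std_parabolic T m K)" using aK push by simp
    then show ?thesis using b(1) aK(2) by (auto simp: parabolic_def)
  qed
  obtain P' Q' where P': "parabolic T m P'" "P = \<iota> ` P'" and Q': "parabolic T m Q'" "Q = \<iota> ` Q'"
    using pull[OF P] pull[OF Q] by blast
  have "P \<inter> Q = \<iota> ` (P' \<inter> Q')"
    unfolding P'(2) Q'(2)
    using T.parabolic_closed[OF P'(1)] T.parabolic_closed[OF Q'(1)] by (rule inj_on_image_Int[OF inj, symmetric])
  moreover obtain b X where "b \<in> carrier ?H" "X \<subseteq> T" "P' \<inter> Q' = conj_subgroup ?H b (std_parabolic T m X)"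
    using IH[OF P'(1) Q'(1)] by (auto simp: parabolic_def)
  ultimately show ?thesis
    using push[of b X] T \<iota>.hom_closed[of b] unfolding parabolic_def
    by (intro bexI[of _ "\<iota> b"] exI[of _ X]) auto
qed

text \<open>Sending each vertex outside \<open>X\<close> to its odd partner and fixing the others is
  an injection. By symmetry the two cores have equal size.\<close>

lemma card_core:
  assumes "X \<subseteq> S" "Y \<subseteq> S"
  shows "card (core m Y X) \<le> card (core m X Y)"
proof -
  have fin: "finite S" using labels by (simp add: artin_labels_def)
  define p where "p y = (if y \<in> X then y else (SOME x. x \<in> X - Y \<and> odd_label m y x))" for y
  have p: "p y \<in> X - Y \<and> odd_label m y (p y)" if y: "y \<in> odd_part m Y X" for y
  proof -
    have "\<exists>x. x \<in> X - Y \<and> odd_label m y x" "y \<notin> X" using y by (auto simp: odd_part_def)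
    then show ?thesis unfolding p_def by (simp only: if_False) (rule someI_ex)
  qed
  have p_id: "p y = y" if "y \<in> X" for y using that by (simp add: p_def)
  have odd: "odd_label m (p y) y" if "y \<in> odd_part m Y X" for y
    using p[OF that] that odd_label_commute[OF labels, of y "p y"] assms by (auto simp: odd_part_def)
  have "inj_on p (core m Y X)"
  proof (rule inj_onI)
    fix y z assume yz: "y \<in> core m Y X" "z \<in> core m Y X" "p y = p z"
    show "y = z"
    proof (cases "y \<in> X \<or> z \<in> X")
      case True
      \<comment> \<open>Fixed vertices lie in \<open>Y\<close> and partners do not, so the two kinds
        have disjoint images.\<close>
      have "w \<in> X \<longrightarrow> p w = w \<and> p w \<in> Y" "w \<notin> X \<longrightarrow> p w \<notin> Y" if "w \<in> core m Y X" for w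
        using that p[of w] p_id[of w] core_subset[of Y X] by (auto simp: core_def)
      then show ?thesis using yz True by metis
    next
      case False
      then have o: "y \<in> odd_part m Y X" "z \<in> odd_part m Y X" using yz by (auto simp: core_def)
      then have "y \<in> S" "z \<in> S" "p y \<in> S" using p[OF o(1)] assms by (auto simp: odd_part_def)
      then show ?thesis using odd_partner_unique odd[OF o(1)] odd[OF o(2)] yz(3) by metis
    qed
  qed
  moreover have "p ` core m Y X \<subseteq> core m X Y"
  proof
    fix x assume "x \<in> p ` core m Y X"
    then obtain y where y: "y \<in> core m Y X" "x = p y" by blast
    show "x \<in> core m X Y"
    proof (cases "y \<in> X")
      case True
      then show ?thesis using y p_id by (auto simp: core_def odd_part_def)
    next
      case False
      then have o: "y \<in> odd_part m Y X" using y by (auto simp: core_def)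
      then show ?thesis using p[OF o] odd[OF o] y(2) by (auto simp: core_def odd_part_def)
    qed
  qed
  moreover have "finite (core m X Y)"
    using core_subset[of X Y] assms fin by (meson finite_subset)
  ultimately show ?thesis by (rule card_inj_on_le)
qed

text \<open>No relation involves \<open>x\<close> and a vertex outside its star, so that every relation lives in one
  of the two factors.\<close>

lemma star_amalgam:
  assumes x: "x \<in> S"
  defines "V \<equiv> \<lambda>\<sigma>. std_parabolic S m (if \<sigma> then S - {x} else artin_star S m x)"
  shows "amalgam G V"
    and "V True \<inter> V False = std_parabolic S m (artin_star S m x - {x})"
proof -
  let ?g = "artin_gen S m"
  define T where "T \<sigma> = (if \<sigma> then S - {x} else artin_star S m x)" for \<sigma>
  have T: "T \<sigma> \<subseteq> S" for \<sigma> using x by (auto simp: T_def artin_star_def)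
  have V: "V \<sigma> = std_parabolic S m (T \<sigma>)" for \<sigma> by (simp add: V_def T_def)
  have gens: "?g ` T \<sigma> \<subseteq> carrier G" for \<sigma> using T by (rule artin_gens_closed)
  have gen_V: "?g s \<in> V \<sigma>" if "s \<in> T \<sigma>" for s \<sigma>
    using that unfolding V by (rule artin_gen_in_std_parabolic)
  show "amalgam G V"
  proof (intro amalgam.intro amalgam_axioms.intro group_artin_group)
    show sub: "subgroup (V \<sigma>) G" for \<sigma> unfolding V using T by (rule std_parabolic_subgroup)
    have "?g ` S \<subseteq> V True \<union> V False"
      using gen_V[of _ True] gen_V[of x False] by (auto simp: T_def artin_star_def)
    then have "std_parabolic S m S \<subseteq> generate G (V True \<union> V False)"
      unfolding std_parabolic_def by (rule mono_generate)
    moreover have "generate G (V True \<union> V False) \<subseteq> carrier G"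
      using sub subgroup.subset by (intro generate_incl) blast
    ultimately show "generate G (V True \<union> V False) = carrier G"
      by (simp add: std_parabolic_carrier)
    fix \<Omega> :: "('a word set \<times> (bool \<times> 'a word set) list) set" and act
    assume act: "\<And>\<sigma>. act \<sigma> \<in> hom (G\<lparr>carrier := V \<sigma>\<rparr>) (BijGroup \<Omega>)"
      and agree: "\<And>v. v \<in> V True \<Longrightarrow> v \<in> V False \<Longrightarrow> act True v = act False v"
    have hom: "group_hom (G\<lparr>carrier := V \<sigma>\<rparr>) (BijGroup \<Omega>) (act \<sigma>)" for \<sigma>
      by (intro group_hom.intro group_hom_axioms.intro group_BijGroup act subgroup_imp_group sub)
    \<comment> \<open>A generator in both factors has one image by \<open>agree\<close>, so the
      preference for \<open>True\<close> is harmless.\<close>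
    define f where "f s = (if s \<in> T True then act True (?g s) else act False (?g s))" for s
    have f: "f s = act \<sigma> (?g s)" if "s \<in> T \<sigma>" for s \<sigma>
      using that agree[of "?g s"] gen_V[of s] by (cases \<sigma>) (auto simp: f_def)
    have alt: "altprod (G\<lparr>carrier := V \<sigma>\<rparr>) a b k = altprod G a b k" for \<sigma> a b k
      by (induction k arbitrary: a b) auto
    have "\<exists>\<phi>\<in>hom G (BijGroup \<Omega>). \<forall>s\<in>S. \<phi> (?g s) = f s"
    proof (rule artin_hom_exists[OF group_BijGroup])
      show "f \<in> S \<rightarrow> carrier (BijGroup \<Omega>)"
      proof
        fix s assume "s \<in> S"
        then have "s \<in> T (s \<noteq> x)" by (simp add: T_def artin_star_def)
        then obtain \<sigma> where "s \<in> T \<sigma>" by blast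
        then show "f s \<in> carrier (BijGroup \<Omega>)"
          using f gen_V group_hom.hom_closed[OF hom[of \<sigma>], of "?g s"] by simp
      qed
      fix s t k assume st: "s \<in> S" "t \<in> S" "s \<noteq> t" "m s t = enat k"
      have "m t s = enat k" using st labels by (auto simp: artin_labels_def)
      \<comment> \<open>If neither vertex is \<open>x\<close>, both lie in the first factor;
        otherwise one is \<open>x\<close>, and the finite label puts the other in its star.\<close>
      then have "s \<in> T (s \<noteq> x \<and> t \<noteq> x) \<and> t \<in> T (s \<noteq> x \<and> t \<noteq> x)"
        using st by (auto simp: T_def artin_star_def)
      then obtain \<sigma> where \<sigma>: "s \<in> T \<sigma>" "t \<in> T \<sigma>" by blast
      have "altprod (BijGroup \<Omega>) (f a) (f b) k = act \<sigma> (altprod G (?g a) (?g b) k)"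
        if "a \<in> T \<sigma>" "b \<in> T \<sigma>" for a b
        using that f gen_V group_hom.altprod_hom[OF hom[of \<sigma>], of "?g a" "?g b" k] by (simp add: alt)
      then show "altprod (BijGroup \<Omega>) (f s) (f t) k = altprod (BijGroup \<Omega>) (f t) (f s) k"
        using \<sigma> artin_relation[of s S t m k] st by simp
    qed
    then obtain \<phi> where \<phi>: "\<phi> \<in> hom G (BijGroup \<Omega>)" "\<And>s. s \<in> S \<Longrightarrow> \<phi> (?g s) = f s" by blast
    interpret \<phi>: group_hom G "BijGroup \<Omega>" \<phi>
      by (intro group_hom.intro group_hom_axioms.intro is_group group_BijGroup \<phi>)
    have "\<phi> v = act \<sigma> v" if "v \<in> V \<sigma>" for \<sigma> v
    proof -
      interpret A: group_hom "G\<lparr>carrier := V \<sigma>\<rparr>" "BijGroup \<Omega>" "act \<sigma>" by (rule hom)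
      have eq: "\<phi> (?g s) = act \<sigma> (?g s)" if "s \<in> T \<sigma>" for s
        using that \<phi>(2) f T by (metis subsetD)
      show ?thesis
        using that unfolding V std_parabolic_def
      proof (induction rule: generate.induct)
        case one
        then show ?case using A.hom_one by simp
      next
        case (incl h)
        then show ?case using eq by blast
      next
        case (inv h)
        then obtain s where s: "s \<in> T \<sigma>" "h = ?g s" by blast
        then have "h \<in> V \<sigma>" using gen_V by simp
        then have "act \<sigma> (inv\<^bsub>G\<^esub> h) = inv\<^bsub>BijGroup \<Omega>\<^esub> act \<sigma> h"
          using A.hom_inv[of h] m_inv_consistent[OF sub, of h \<sigma>] by (simp del: A.hom_inv)
        moreover have "h \<in> carrier G" using subsetD[OF gens[of \<sigma>], of h] s by simp
        ultimately show ?case using eq s by simp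
      next
        case (eng h1 h2)
        then have "h1 \<in> V \<sigma>" "h2 \<in> V \<sigma>" by (simp_all add: V std_parabolic_def)
        then show ?case
          using A.hom_mult[of h1 h2] eng subgroup.mem_carrier[OF sub] by simp
      qed
    qed
    then show "\<exists>\<phi>\<in>hom G (BijGroup \<Omega>). \<forall>\<sigma>. \<forall>v\<in>V \<sigma>. \<phi> v = act \<sigma> v" using \<phi>(1) by blast
  qed
  have "T True \<inter> T False = artin_star S m x - {x}" using T[of False] by (auto simp: T_def)
  moreover have "V True \<inter> V False \<subseteq> std_parabolic S m (T True \<inter> T False)"
  proof
    fix h assume h: "h \<in> V True \<inter> V False"
    obtain \<rho> where \<rho>: "ordinary_retraction S m (T False) \<rho>" using obtain_retraction[OF T] .
    have "h = \<rho> h" using h ordinary_retraction_id[OF \<rho> T] by (simp add: V)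
    also have "\<dots> \<in> \<rho> ` V True" using h by blast
    also have "\<rho> ` V True = std_parabolic S m (core m (T False) (T True))"
      unfolding V by (rule ordinary_retraction_std_parabolic[OF labels \<rho> T T])
    \<comment> \<open>The only candidate for the odd part is \<open>x\<close>, whose odd partners
      all lie in its star.\<close>
    also have "core m (T False) (T True) = T True \<inter> T False"
      by (auto simp: core_def odd_part_def T_def artin_star_def odd_label_def)
    finally show "h \<in> std_parabolic S m (T True \<inter> T False)" .
  qed
  moreover have "std_parabolic S m (T True \<inter> T False) \<subseteq> V True \<inter> V False"
    unfolding V by (simp add: std_parabolic_mono)
  ultimately show "V True \<inter> V False = std_parabolic S m (artin_star S m x - {x})" by auto
qed

text \<open>Both factors are generated by proper subsets of \<open>S\<close>, so \<open>IH\<close>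
  handles intersections inside them. As \<open>X\<close> and \<open>Y\<close> omit \<open>x\<close>,
  both subgroups start in the first factor and \<open>conj_Int_closed\<close> applies.\<close>

lemma parabolic_Int_amalgam:
  assumes x: "x \<in> S" "artin_star S m x \<noteq> S" and XY: "X \<subseteq> S - {x}" "Y \<subseteq> S - {x}" and g: "g \<in> carrier G"
    and IH: "\<And>T P Q. T \<subset> S \<Longrightarrow> parabolic T m P \<Longrightarrow> parabolic T m Q \<Longrightarrow> parabolic T m (P \<inter> Q)"
  shows "parabolic S m (std_parabolic S m X \<inter> conj_subgroup G g (std_parabolic S m Y))"
proof -
  define T where "T \<sigma> = (if \<sigma> then S - {x} else artin_star S m x)" for \<sigma>
  have T: "T \<sigma> \<subset> S" for \<sigma> using x by (auto simp: T_def artin_star_def)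
  interpret amalgam G "\<lambda>\<sigma>. std_parabolic S m (T \<sigma>)"
    unfolding T_def by (rule star_amalgam(1)[OF x(1)])
  have C: "C = std_parabolic S m (artin_star S m x - {x})"
    unfolding C_def using star_amalgam(2)[OF x(1)] by (simp add: T_def)
  have "std_parabolic S m X \<inter> conj_subgroup G g (std_parabolic S m Y) \<in> {P. parabolic S m P}"
  proof (rule conj_Int_closed[where \<sigma> = True and \<tau> = True])
    fix P Q \<sigma> assume "P \<in> {P. parabolic S m P}" "Q \<in> {P. parabolic S m P}"
      "P \<subseteq> std_parabolic S m (T \<sigma>)" "Q \<subseteq> std_parabolic S m (T \<sigma>)"
    then show "P \<inter> Q \<in> {P. parabolic S m P}"
      using parabolic_Int_transfer[OF psubset_imp_subset[OF T] IH[OF T]] by blast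
  next
    show "std_parabolic S m X \<subseteq> std_parabolic S m (T True)"
      "std_parabolic S m Y \<subseteq> std_parabolic S m (T True)"
      using XY by (simp_all add: T_def std_parabolic_mono)
    show "C \<in> {P. parabolic S m P}"
      unfolding C mem_Collect_eq using x(1) by (intro parabolic_std) (auto simp: artin_star_def)
  next
    fix P h assume "P \<in> {P. parabolic S m P}" "h \<in> carrier G"
    then show "conj_subgroup G h P \<in> {P. parabolic S m P}" by (simp add: parabolic_conj)
  next
    fix P assume "P \<in> {P. parabolic S m P}"
    then show "P \<subseteq> carrier G" by (simp add: parabolic_closed)
  next
    have "X \<subseteq> S" "Y \<subseteq> S" using XY by auto
    then show "std_parabolic S m X \<in> {P. parabolic S m P}" "std_parabolic S m Y \<in> {P. parabolic S m P}"
      by (simp_all add: parabolic_std)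
  qed (rule g)
  then show ?thesis by simp
qed

text \<open>The retractions to \<open>X\<close> and to \<open>Y\<close> confine the intersection to conjugates of the subgroups on
  the two cores.\<close>

lemma Int_conj_eq_cores:
  assumes X: "X \<subseteq> S" and Y: "Y \<subseteq> S" and g: "g \<in> carrier G"
  shows "\<exists>a\<in>carrier G. \<exists>b\<in>carrier G.
    std_parabolic S m X \<inter> conj_subgroup G g (std_parabolic S m Y) =
    conj_subgroup G a (std_parabolic S m (core m X Y) \<inter>
      conj_subgroup G b (std_parabolic S m (core m Y X)))"
proof -
  let ?A = "std_parabolic S m"
  have core: "core m X Y \<subseteq> S" "core m Y X \<subseteq> S" using X Y core_subset by blast+
  \<comment> \<open>The retraction to \<open>X\<close> fixes the intersection and maps the conjugate
    to one of the core subgroup. Its conjugator \<open>\<rho> g\<close> lies in the subgroup on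
    \<open>X\<close>, which gives the reverse inclusion later.\<close>
  have half: "\<exists>a\<in>?A X. ?A X \<inter> conj_subgroup G g (?A Y) \<subseteq> conj_subgroup G a (?A (core m X Y))"
    if X: "X \<subseteq> S" and Y: "Y \<subseteq> S" and g: "g \<in> carrier G" for X Y g
  proof -
    obtain \<rho> where \<rho>: "ordinary_retraction S m X \<rho>" using obtain_retraction[OF X] .
    interpret \<rho>: group_hom G G \<rho> using \<rho> X by (rule ordinary_retraction_hom)
    have "\<rho> ` conj_subgroup G g (?A Y) = conj_subgroup G (\<rho> g) (?A (core m X Y))"
      using g Y std_parabolic_closed[OF Y]
      by (simp add: \<rho>.conj_subgroup_hom ordinary_retraction_std_parabolic[OF labels \<rho> X])
    moreover have "h = \<rho> h" if "h \<in> ?A X" for h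
      using ordinary_retraction_id[OF \<rho> X that] by simp
    ultimately show ?thesis using ordinary_retraction_mem[OF \<rho> g] by blast
  qed
  let ?I = "?A X \<inter> conj_subgroup G g (?A Y)"
  have car: "?A X \<subseteq> carrier G" "?A Y \<subseteq> carrier G" "?A (core m X Y) \<subseteq> carrier G" "?A (core m Y X) \<subseteq> carrier G"
    using X Y core by (simp_all add: std_parabolic_closed)
  obtain a where a: "a \<in> ?A X" "?I \<subseteq> conj_subgroup G a (?A (core m X Y))"
    using half[OF X Y g] by blast
  obtain b where b: "b \<in> ?A Y"
    "?A Y \<inter> conj_subgroup G (inv\<^bsub>G\<^esub> g) (?A X) \<subseteq> conj_subgroup G b (?A (core m Y X))"
    using half[OF Y X, of "inv\<^bsub>G\<^esub> g"] g by blast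
  have ab: "a \<in> carrier G" "b \<in> carrier G" using a b car by auto
  have "?I = conj_subgroup G g (?A Y \<inter> conj_subgroup G (inv\<^bsub>G\<^esub> g) (?A X))"
    using car g by (simp add: conj_subgroup_Int conj_subgroup_closed conj_subgroup_inv Int_commute)
  also have "\<dots> \<subseteq> conj_subgroup G g (conj_subgroup G b (?A (core m Y X)))"
    by (rule conj_subgroup_mono[OF b(2)])
  finally have I2: "?I \<subseteq> conj_subgroup G (g \<otimes>\<^bsub>G\<^esub> b) (?A (core m Y X))"
    using car ab g by (simp add: conj_subgroup_mult)
  \<comment> \<open>Since \<open>a\<close> and \<open>b\<close> lie in the subgroups on
    \<open>X\<close> and \<open>Y\<close>, the confining conjugates do not exceed the original two
    groups.\<close>
  have "conj_subgroup G a (?A (core m X Y)) \<subseteq> ?A X"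
    using a X by (intro conj_subgroup_subset std_parabolic_subgroup std_parabolic_mono core_subset)
  moreover have "conj_subgroup G (g \<otimes>\<^bsub>G\<^esub> b) (?A (core m Y X)) \<subseteq> conj_subgroup G g (?A Y)"
  proof -
    have "conj_subgroup G b (?A (core m Y X)) \<subseteq> ?A Y"
      using b Y by (intro conj_subgroup_subset std_parabolic_subgroup std_parabolic_mono core_subset)
    from conj_subgroup_mono[OF this, of g] show ?thesis using car ab g by (simp add: conj_subgroup_mult)
  qed
  ultimately have "?I = conj_subgroup G a (?A (core m X Y)) \<inter> conj_subgroup G (g \<otimes>\<^bsub>G\<^esub> b) (?A (core m Y X))"
    using a(2) I2 by blast
  also have "conj_subgroup G (g \<otimes>\<^bsub>G\<^esub> b) (?A (core m Y X))
      = conj_subgroup G a (conj_subgroup G (inv\<^bsub>G\<^esub> a \<otimes>\<^bsub>G\<^esub> (g \<otimes>\<^bsub>G\<^esub> b)) (?A (core m Y X)))"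
    using car ab g by (simp add: conj_subgroup_mult m_assoc[symmetric])
  also have "conj_subgroup G a (?A (core m X Y)) \<inter> \<dots>
      = conj_subgroup G a (?A (core m X Y) \<inter> conj_subgroup G (inv\<^bsub>G\<^esub> a \<otimes>\<^bsub>G\<^esub> (g \<otimes>\<^bsub>G\<^esub> b)) (?A (core m Y X)))"
    using car ab g by (simp add: conj_subgroup_Int conj_subgroup_closed)
  finally show ?thesis using ab g by blast
qed

text \<open>The induction is on the generators of the first subgroup alone, with \<open>Q\<close>
  arbitrary; this permits intersecting the same groups in another order.\<close>

lemma parabolic_Int_step:
  assumes star: "star_condition S m"
    and IH: "\<And>T P Q. T \<subset> S \<Longrightarrow> parabolic T m P \<Longrightarrow> parabolic T m Q \<Longrightarrow> parabolic T m (P \<inter> Q)"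
    and "X \<subseteq> S" "h \<in> carrier G" "P = conj_subgroup G h (std_parabolic S m X)" "parabolic S m Q"
  shows "parabolic S m (P \<inter> Q)"
  using assms(3-6)
proof (induction "card X" arbitrary: X h P Q rule: less_induct)
  case less
  let ?A = "std_parabolic S m"
  have fin: "finite S" using labels by (simp add: artin_labels_def)
  obtain k Y where kY: "k \<in> carrier G" "Y \<subseteq> S" "Q = conj_subgroup G k (?A Y)"
    using less.prems by (auto simp: parabolic_def)
  define C D where "C = core m X Y" and "D = core m Y X"
  have CD: "C \<subseteq> S" "D \<subseteq> S" "C \<subseteq> X"
    using core_subset[of X Y] core_subset[of Y X] less.prems(1) kY(2) by (auto simp: C_def D_def)
  have card: "card C \<le> card X" "card D \<le> card X"
  proof -
    have "finite X" using less.prems fin finite_subset by blast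
    then show "card C \<le> card X" using CD by (simp add: card_mono)
    then show "card D \<le> card X" using card_core[of X Y] less.prems kY by (simp add: C_def D_def)
  qed
  have car: "?A X \<subseteq> carrier G" "?A Y \<subseteq> carrier G" "?A C \<subseteq> carrier G" "?A D \<subseteq> carrier G"
    using less.prems kY CD by (simp_all add: std_parabolic_closed)
  have core_case: "parabolic S m (?A C \<inter> conj_subgroup G b (?A D))" if b: "b \<in> carrier G" for b
  proof (cases "\<forall>x\<in>S - (C \<union> D). artin_star S m x = S")
    case False
    \<comment> \<open>Both cores avoid this vertex, so its star splits the group with both core
      subgroups in the first factor.\<close>
    then obtain x where x: "x \<in> S" "artin_star S m x \<noteq> S" "x \<notin> C" "x \<notin> D" by blast
    then show ?thesis using CD b IH by (intro parabolic_Int_amalgam[OF x(1,2)]) auto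
  next
    case True
    note star[unfolded star_condition_def, THEN spec, THEN mp, OF less.prems(1),
        THEN spec, THEN mp, OF kY(2), THEN bspec, OF b, THEN mp, folded C_def D_def, OF True]
    then consider "?A C = conj_subgroup G b (?A D)"
      | d H where "d \<in> carrier G" "H \<subset> C \<or> H \<subset> D"
        "?A C \<inter> conj_subgroup G b (?A D) \<subseteq> conj_subgroup G d (?A H)"
      by blast
    then show ?thesis
    proof cases
      case 1
      then show ?thesis using parabolic_std[OF CD(1)] by simp
    next
      case (2 d H)
      have H: "H \<subseteq> S" using 2 CD by auto
      \<comment> \<open>Whichever core contains \<open>H\<close> properly, neither has more than
        \<open>card X\<close> elements.\<close>
      have "card H < card C \<or> card H < card D"
        using 2(2) CD fin by (meson finite_subset psubset_card_mono)
      with card have "card H < card X" by linarith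
      have conjD: "parabolic S m (conj_subgroup G b (?A D))"
        using b CD by (intro parabolic_conj parabolic_std)
      \<comment> \<open>First use of the induction hypothesis: start from the smaller conjugate
        containing the intersection.\<close>
      define R where "R = conj_subgroup G d (?A H) \<inter> conj_subgroup G b (?A D)"
      have R: "parabolic S m R"
        unfolding R_def using \<open>card H < card X\<close> H 2(1) conjD by (intro less.hyps[of H d]) auto
      then obtain a K where K: "a \<in> carrier G" "K \<subseteq> H" "R = conj_subgroup G a (?A K)"
        using parabolic_in_conj[OF H 2(1) R] by (auto simp: R_def)
      \<comment> \<open>Second use: \<open>R\<close> is a conjugate of the subgroup on some
        \<open>K\<close> with \<open>card K \<le> card H\<close>, so it may be intersected with the
        other core subgroup as well.\<close>
      have "finite H" using H fin finite_subset by blast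
      then have "card K < card X"
        using card_mono[OF _ K(2)] \<open>card H < card X\<close> by simp
      then have "parabolic S m (R \<inter> ?A C)"
        using K H CD by (intro less.hyps[of K a]) (auto simp: parabolic_std)
      moreover have "R \<inter> ?A C = ?A C \<inter> conj_subgroup G b (?A D)"
        using 2(3) by (auto simp: R_def)
      ultimately show ?thesis by simp
    qed
  qed
  have "P \<inter> Q = conj_subgroup G h (?A X \<inter> conj_subgroup G (inv\<^bsub>G\<^esub> h \<otimes>\<^bsub>G\<^esub> k) (?A Y))"
    using less.prems kY car
    by (simp add: conj_subgroup_Int conj_subgroup_closed conj_subgroup_mult m_assoc[symmetric])
  moreover obtain a b where "a \<in> carrier G" "b \<in> carrier G"
    "?A X \<inter> conj_subgroup G (inv\<^bsub>G\<^esub> h \<otimes>\<^bsub>G\<^esub> k) (?A Y) = conj_subgroup G a (?A C \<inter> conj_subgroup G b (?A D))"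
    using Int_conj_eq_cores[OF less.prems(1) kY(2), of "inv\<^bsub>G\<^esub> h \<otimes>\<^bsub>G\<^esub> k"] less.prems(2) kY(1)
    unfolding C_def D_def by auto
  ultimately show ?case
    using less.prems(2) by (simp add: parabolic_conj core_case)
qed

end

text \<open>The outer induction on the vertex set; all conditions pass to subsets.\<close>

lemma parabolic_Int:
  assumes "retractable S m" "\<And>T. T \<subseteq> S \<Longrightarrow> star_condition T m"
    and "parabolic S m P" "parabolic S m Q"
  shows "parabolic S m (P \<inter> Q)"
proof -
  have "finite S" using assms(1) by (simp add: retractable_def artin_labels_def)
  then show ?thesis
    using assms
  proof (induction S arbitrary: P Q rule: finite_psubset_induct)
    case (psubset S)
    interpret retractable S m by (rule psubset.prems(1))
    obtain h X where "h \<in> carrier G" "X \<subseteq> S" "P = conj_subgroup G h (std_parabolic S m X)"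
      using psubset.prems(3) by (auto simp: parabolic_def)
    moreover have "parabolic T m (P' \<inter> Q')" if "T \<subset> S" "parabolic T m P'" "parabolic T m Q'" for T P' Q'
      using that retractable_subset[OF psubset.prems(1), of T] psubset.prems(2)
      by (intro psubset.IH) auto
    ultimately show ?case
      using psubset.prems(2,4) by (intro parabolic_Int_step[of X h P Q]) auto
  qed
qed

section \<open>Families with property C\<close>

text \<open>The family provides a subgraph with labels that agree with \<open>m\<close> only on
  distinct vertices of \<open>T\<close>. This and the following congruences bring its properties
  back to \<open>m\<close>.\<close>

lemma artin_group_cong:
  assumes "\<forall>s\<in>T. \<forall>t\<in>T. s \<noteq> t \<longrightarrow> m' s t = m s t"
  shows "artin_group T m' = artin_group T m" and "artin_gen T m' = artin_gen T m"
proof -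
  have "artin_relations T m' = artin_relations T m"
    using assms unfolding artin_relations_def by (intro Collect_cong) metis
  then show "artin_group T m' = artin_group T m" "artin_gen T m' = artin_gen T m"
    by (simp_all add: artin_group_def artin_gen_def fun_eq_iff)
qed

lemma odd_label_cong:
  "\<forall>s\<in>T. \<forall>t\<in>T. s \<noteq> t \<longrightarrow> m' s t = m s t \<Longrightarrow> s \<in> T \<Longrightarrow> t \<in> T \<Longrightarrow>
    odd_label m' s t \<longleftrightarrow> odd_label m s t"
  by (auto simp: odd_label_def)

lemma admits_ordinary_retractions_cong:
  assumes "\<forall>s\<in>T. \<forall>t\<in>T. s \<noteq> t \<longrightarrow> m' s t = m s t"
  shows "admits_ordinary_retractions T m' \<longleftrightarrow> admits_ordinary_retractions T m"
proof -
  have "ordinary_retraction T m' X \<rho> \<longleftrightarrow> ordinary_retraction T m X \<rho>" if "X \<subseteq> T" for X \<rho>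
  proof -
    have odd: "odd_label m' v a \<longleftrightarrow> odd_label m v a" if "v \<in> T - X" "a \<in> X" for v a
      using that \<open>X \<subseteq> T\<close> by (intro odd_label_cong[OF assms]) auto
    have "(\<forall>v\<in>T - X. \<forall>a\<in>X. odd_label m' v a \<longrightarrow> R v a) \<longleftrightarrow> (\<forall>v\<in>T - X. \<forall>a\<in>X. odd_label m v a \<longrightarrow> R v a)"
      "(\<forall>v\<in>T - X. (\<forall>a\<in>X. \<not> odd_label m' v a) \<longrightarrow> R' v)
        \<longleftrightarrow> (\<forall>v\<in>T - X. (\<forall>a\<in>X. \<not> odd_label m v a) \<longrightarrow> R' v)" for R R'
      using odd by auto
    then show ?thesis
      unfolding ordinary_retraction_def std_parabolic_def artin_group_cong[OF assms] by simp
  qed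
  then show ?thesis by (auto simp: admits_ordinary_retractions_def)
qed

lemma star_condition_cong:
  assumes "\<forall>s\<in>T. \<forall>t\<in>T. s \<noteq> t \<longrightarrow> m' s t = m s t"
    and "star_condition T m'"
  shows "star_condition T m"
proof -
  have core: "core m' X Y = core m X Y" if "X \<subseteq> T" "Y \<subseteq> T" for X Y
  proof -
    have "odd_label m' x y \<longleftrightarrow> odd_label m x y" if "x \<in> X" "y \<in> Y" for x y
      using that \<open>X \<subseteq> T\<close> \<open>Y \<subseteq> T\<close> by (intro odd_label_cong[OF assms(1)]) auto
    then show ?thesis by (auto simp: core_def odd_part_def)
  qed
  have "artin_star T m' x = artin_star T m x" if "x \<in> T" for x
    using that assms(1) by (auto simp: artin_star_def)
  then have star: "(\<forall>x\<in>T - U. artin_star T m' x = T) \<longleftrightarrow> (\<forall>x\<in>T - U. artin_star T m x = T)" for U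
    by auto
  have "std_parabolic T m' = std_parabolic T m"
    by (simp add: std_parabolic_def artin_group_cong[OF assms(1)] fun_eq_iff)
  note group_eq = this artin_group_cong[OF assms(1)]
  show ?thesis
    unfolding star_condition_def
  proof (intro allI ballI impI)
    fix X Y g
    assume XY: "X \<subseteq> T" "Y \<subseteq> T" and g: "g \<in> carrier (artin_group T m)"
      and st: "\<forall>x\<in>T - (core m X Y \<union> core m Y X). artin_star T m x = T"
    note cores = core[OF XY] core[OF XY(2,1)]
    have "\<forall>x\<in>T - (core m' X Y \<union> core m' Y X). artin_star T m' x = T"
      using st unfolding star cores .
    moreover have "g \<in> carrier (artin_group T m')" using g by (simp only: group_eq)
    moreover note assms(2)[unfolded star_condition_def, THEN spec, THEN mp, OF XY(1),
        THEN spec, THEN mp, OF XY(2), THEN bspec, THEN mp]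
    ultimately show "std_parabolic T m (core m X Y)
          = conj_subgroup (artin_group T m) g (std_parabolic T m (core m Y X)) \<or>
        (\<exists>d\<in>carrier (artin_group T m). \<exists>H. (H \<subset> core m X Y \<or> H \<subset> core m Y X) \<and>
           std_parabolic T m (core m X Y)
               \<inter> conj_subgroup (artin_group T m) g (std_parabolic T m (core m Y X))
             \<subseteq> conj_subgroup (artin_group T m) d (std_parabolic T m H))"
      unfolding group_eq cores by (simp only: simp_thms)
  qed
qed

theorem theorem4p13:
  fixes \<F> :: "('a set \<times> 'a labels) set" and S :: "'a set" and m :: "'a labels"
    and P Q :: "'a word set set"
  assumes "odd_odd_free_family \<F>"
    and "property_C \<F>"
    and "(S, m) \<in> \<F>"
    and "parabolic S m P"
    and "parabolic S m Q"
  shows "parabolic S m (P \<inter> Q)"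
proof -
  have sub: "admits_ordinary_retractions T m \<and> star_condition T m" if "T \<subseteq> S" for T
  proof -
    have "closed_under_subgraphs \<F>"
      using assms(2) by (simp add: property_C_def)
    from bspec[OF this[unfolded closed_under_subgraphs_def] assms(3)] that
    have "\<exists>m'. (T, m') \<in> \<F> \<and> (\<forall>s\<in>T. \<forall>t\<in>T. s \<noteq> t \<longrightarrow> m' s t = m s t)"
      by simp
    then obtain m' where m': "(T, m') \<in> \<F>"
      and eq: "\<forall>s\<in>T. \<forall>t\<in>T. s \<noteq> t \<longrightarrow> m' s t = m s t" by blast
    from assms(2) have "\<forall>(S, m)\<in>\<F>. admits_ordinary_retractions S m" "\<forall>(S, m)\<in>\<F>. star_condition S m"
      by (simp_all add: property_C_def)
    from bspec[OF this(1) m'] bspec[OF this(2) m']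
    have "admits_ordinary_retractions T m'" "star_condition T m'"
      by simp_all
    then show ?thesis
      using admits_ordinary_retractions_cong[OF eq] star_condition_cong[OF eq]
      by simp
  qed
  have "artin_labels S m" "odd_odd_free S m"
    using bspec[OF assms(1)[unfolded odd_odd_free_family_def] assms(3)] by simp_all
  then have "retractable S m"
    using sub by unfold_locales blast+
  then show ?thesis
    using sub assms(4,5) by (intro parabolic_Int) blast+
qed

end
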